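(* Let $\mathbb{F}$ be a field of characteristic $0$, and let $\mathcal{W}(0)$ be the Lie conformal algebra that is the free $\mathbb{F}[\partial]$-module on $L,H$ with $[L_\lambda L]=(\partial+2\lambda)L$, $[L_\lambda H]=(\partial+\lambda)H$, $[H_\lambda L]=\lambda H$, $[H_\lambda H]=0$. For $\Delta,\beta\in\mathbb{F}$ let $M_{\Delta,\beta,0}=\mathbb{F}[\partial]m$ be the $\mathcal{W}(0)$-module, free of rank one over $\mathbb{F}[\partial]$, with $L_\lambda m=(\partial+\Delta\lambda)m$ and $H_\lambda m=\beta m$. If $\beta\ne 0$, then $$\widetilde{\mathrm{H}}^\bullet(\mathcal{W}(0),M_{\Delta,\beta,0})=\mathrm{H}^\bullet(\mathcal{W}(0),M_{\Delta,\beta,0})=0,$$ i.e. the basic and reduced cohomology vanish in all degrees.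
   Context: Lie conformal algebra (LCA): an $\mathbb{F}[\partial]$-module $\mathcal{A}$ with an $\mathbb{F}$-bilinear $\lambda$-bracket $\mathcal{A}\otimes\mathcal{A}\to\mathcal{A}[\lambda]$, $a\otimes b\mapsto[a_\lambda b]$, such that $[\partial a_\lambda b]=-\lambda[a_\lambda b]$, $[a_\lambda\partial b]=(\partial+\lambda)[a_\lambda b]$, $[a_\lambda b]=-[b_{-\lambda-\partial}a]$, and $[a_\lambda[b_\mu c]]=[[a_\lambda b]_{\lambda+\mu}c]+[b_\mu[a_\lambda c]]$. The $\lambda$-bracket on $\mathbb{F}[\partial]$-generators determines it everywhere. An $\mathcal{A}$-module is an $\mathbb{F}[\partial]$-module $M$ with an $\mathbb{F}$-bilinear $\lambda$-action $a\otimes m\mapsto a_\lambda m\in M[\lambda]$ such that $(\partial a)_\lambda m=-\lambda a_\lambda m$, $a_\lambda(\partial m)=(\partial+\lambda)a_\lambda m$, $a_\lambda(b_\mu m)-b_\mu(a_\lambda m)=[a_\lambda b]_{\lambda+\mu}m$. Write $\partial^M$ for the action of $\partial$ on $M$. Basic complex: for $q\ge 1$, $\widetilde{C}^q(\mathcal{A},M)$ is the space of $\mathbb{F}$-linear maps $f:\mathcal{A}^{\otimes q}\to M[\lambda_1,\dots,\lambda_q]$, $a_1\otimes\cdots\otimes a_q\mapsto f_{\lambda_1,\dots,\lambda_q}(a_1,\dots,a_q)$, with $f_{\lambda_1,\dots,\lambda_q}(a_1,\dots,\partial a_i,\dots,a_q)=-\lambda_i f_{\lambda_1,\dots,\lambda_q}(a_1,\dots,a_q)$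 for all $i$, and skew-symmetric under simultaneous permutations of the $a_i$ and the $\lambda_i$. Also $\widetilde{C}^0(\mathcal{A},M)=M$. The differential is $$(\mathbf{d}f)_{\lambda_1,\dots,\lambda_{q+1}}(a_1,\dots,a_{q+1})=\sum_{k}(-1)^{k+1}a_{k\,\lambda_k}f_{\lambda_1,\dots,\hat\lambda_k,\dots,\lambda_{q+1}}(a_1,\dots,\hat a_k,\dots,a_{q+1})+\sum_{k<l}(-1)^{k+l}f_{\lambda_k+\lambda_l,\lambda_1,\dots,\hat\lambda_k,\dots,\hat\lambda_l,\dots,\lambda_{q+1}}([a_{k\,\lambda_k}a_l],a_1,\dots,\hat a_k,\dots,\hat a_l,\dots,a_{q+1}),$$ with $(\mathbf{d}m)_\lambda(a)=a_\lambda m$ for $m\in M$; hats denote omission, and polynomial coefficients in the $\lambda$'s are extended linearly. One has $\mathbf{d}^2=0$. Define $(\partial f)_{\lambda_1,\dots,\lambda_q}(a_1,\dots,a_q)=(\partial^M+\sum_{k=1}^q\lambda_k)f_{\lambda_1,\dots,\lambda_q}(a_1,\dots,a_q)$; then $\mathbf{d}\partial=\partial\mathbf{d}$. The reduced complex is $C^\bullet(\mathcal{A},M)=\widetilde{C}^\bullet(\mathcal{A},M)/\partial\widetilde{C}^\bullet(\mathcal{A},M)$. The basic cohomology $\widetilde{\mathrm{H}}^\bullet(\mathcal{A},M)$ is the cohomology of $\widetilde{C}^\bullet(\mathcal{A},M)$; the reduced cohomology $\mathrm{H}^\bullet(\mathcal{A},M)$ is the cohomology of $C^\bullet(\mathcal{A},M)$.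 *)

theory Defs
  imports
    "HOL-Computational_Algebra.Polynomial"
    "HOL-Combinatorics.Permutations"
    "HOL-Library.Poly_Mapping"
    "HOL-Library.Function_Algebras"
    "HOL-Algebra.Elementary_Groups"
begin

section \<open>Polynomials in the formal variables, with coefficients in a module\<close>

text \<open>
  Throughout, \<open>F[\<partial>]\<close> is the ring \<open>'a poly\<close>, with \<open>\<partial>\<close> the polynomial \<open>[:0, 1:]\<close>, and an
  \<open>F[\<partial>]\<close>-module on a type \<open>'m\<close> is a scalar multiplication \<open>s :: 'a poly \<Rightarrow> 'm \<Rightarrow> 'm\<close>
  satisfying \<open>module s\<close>. Its underlying \<open>F\<close>-vector space structure is \<open>\<lambda>c. s [:c:]\<close>.

  \<open>'m mpol\<close> is the set of polynomials over \<open>'m\<close> in variables \<open>\<lambda>\<^sub>0, \<lambda>\<^sub>1, \<dots>\<close>, an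
  exponent vector being an element of \<open>nat \<Rightarrow>\<^sub>0 nat\<close>. The commutative ring \<open>'a poly mpol\<close>,
  that is \<open>F[\<partial>][\<lambda>\<^sub>0, \<lambda>\<^sub>1, \<dots>]\<close>, acts on \<open>'m mpol\<close> (\<open>pscale\<close>). Variables are numbered from 0.
\<close>

type_synonym 'm mpol = "(nat \<Rightarrow>\<^sub>0 nat) \<Rightarrow>\<^sub>0 'm"

abbreviation coef :: "('i \<Rightarrow>\<^sub>0 'c::zero) \<Rightarrow> 'i \<Rightarrow> 'c"
  where "coef \<equiv> Poly_Mapping.lookup"

abbreviation supp :: "('i \<Rightarrow>\<^sub>0 'c::zero) \<Rightarrow> 'i set"
  where "supp \<equiv> Poly_Mapping.keys"

definition lmonom :: "(nat \<Rightarrow>\<^sub>0 nat) \<Rightarrow> 'a::field poly mpol"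
  where "lmonom \<alpha> = Poly_Mapping.single \<alpha> 1"

definition var :: "nat \<Rightarrow> 'a::field poly mpol"
  where "var i = lmonom (Poly_Mapping.single i 1)"

definition const :: "'m::zero \<Rightarrow> 'm mpol"
  where "const v = Poly_Mapping.single 0 v"

definition del :: "'a::field poly mpol"
  where "del = const [:0, 1:]"

definition pscale ::
    "('a::field poly \<Rightarrow> 'm \<Rightarrow> 'm) \<Rightarrow> 'a poly mpol \<Rightarrow> 'm::ab_group_add mpol \<Rightarrow> 'm mpol"
  where "pscale s r v =
    (\<Sum>\<alpha>\<in>supp r. \<Sum>\<beta>\<in>supp v. Poly_Mapping.single (\<alpha> + \<beta>) (s (coef r \<alpha>) (coef v \<beta>)))"

definition psubst ::
    "('a::field poly \<Rightarrow> 'm \<Rightarrow> 'm) \<Rightarrow> (nat \<Rightarrow> 'a poly mpol) \<Rightarrow> 'm::ab_group_add mpol \<Rightarrow> 'm mpol"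
  where "psubst s \<sigma> p =
    (\<Sum>\<alpha>\<in>supp p. pscale s (\<Prod>i\<in>supp \<alpha>. \<sigma> i ^ coef \<alpha> i) (const (coef p \<alpha>)))"

definition free_on :: "('r::comm_ring_1 \<Rightarrow> 'm::ab_group_add \<Rightarrow> 'm) \<Rightarrow> 'm set \<Rightarrow> bool"
  where "free_on s B \<longleftrightarrow> \<not> module.dependent s B \<and> module.span s B = UNIV"

section \<open>Lie conformal algebras and their modules\<close>

text \<open>
  A \<open>\<lambda>\<close>-bracket or \<open>\<lambda>\<close>-action is a map \<open>op\<close> into one-variable polynomials, the variable of
  \<open>'m poly\<close> being \<open>\<lambda>\<close>. For \<open>u = \<Sum>\<alpha>. u\<^sub>\<alpha> \<lambda>\<^sup>\<alpha>\<close> and \<open>v = \<Sum>\<beta>. v\<^sub>\<beta> \<lambda>\<^sup>\<beta>\<close>, the term \<open>lam_at s op \<sigma> u v\<close>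
  stands for \<open>u\<^sub>\<sigma> v\<close>: the product is extended linearly to polynomial coefficients in both
  arguments, and \<open>\<sigma>\<close> is substituted for \<open>\<lambda>\<close>. If \<open>\<partial>\<close> occurs in \<open>\<sigma>\<close>, it is moved to the left of
  the coefficients.
\<close>

definition lam_at ::
    "('a::field poly \<Rightarrow> 'm \<Rightarrow> 'm) \<Rightarrow> ('b \<Rightarrow> 'm \<Rightarrow> 'm poly) \<Rightarrow> 'a poly mpol
      \<Rightarrow> 'b::zero mpol \<Rightarrow> 'm::ab_group_add mpol \<Rightarrow> 'm mpol"
  where "lam_at s op \<sigma> u v =
    (\<Sum>\<alpha>\<in>supp u. \<Sum>\<beta>\<in>supp v. \<Sum>n\<le>degree (op (coef u \<alpha>) (coef v \<beta>)).
      pscale s (lmonom (\<alpha> + \<beta>) * \<sigma> ^ n) (const (coeff (op (coef u \<alpha>) (coef v \<beta>)) n)))"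

locale lie_conformal_algebra = module sA
  for sA :: "'a::field poly \<Rightarrow> 'b::ab_group_add \<Rightarrow> 'b" +
  fixes br :: "'b \<Rightarrow> 'b \<Rightarrow> 'b poly"
  assumes br_add_left: "br (a + a') b = br a b + br a' b"
    and br_add_right: "br a (b + b') = br a b + br a b'"
    and br_scale_left: "br (sA [:t:] a) b = map_poly (sA [:t:]) (br a b)"
    and br_scale_right: "br a (sA [:t:] b) = map_poly (sA [:t:]) (br a b)"
    and br_sesquilinear_left:
      "lam_at sA br (var 0) (const (sA [:0, 1:] a)) (const b)
        = pscale sA (- var 0) (lam_at sA br (var 0) (const a) (const b))"
    and br_sesquilinear_right:
      "lam_at sA br (var 0) (const a) (const (sA [:0, 1:] b))
        = pscale sA (del + var 0) (lam_at sA br (var 0) (const a) (const b))"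
    and br_skew:
      "lam_at sA br (var 0) (const a) (const b)
        = - lam_at sA br (- var 0 - del) (const b) (const a)"
    and br_jacobi:
      "lam_at sA br (var 0) (const a) (lam_at sA br (var 1) (const b) (const c))
        = lam_at sA br (var 0 + var 1) (lam_at sA br (var 0) (const a) (const b)) (const c)
          + lam_at sA br (var 1) (const b) (lam_at sA br (var 0) (const a) (const c))"

locale lca_module = lie_conformal_algebra sA br + M: module sM
  for sA :: "'a::field poly \<Rightarrow> 'b::ab_group_add \<Rightarrow> 'b" and br
    and sM :: "'a poly \<Rightarrow> 'm::ab_group_add \<Rightarrow> 'm" +
  fixes act :: "'b \<Rightarrow> 'm \<Rightarrow> 'm poly"
  assumes act_add_left: "act (a + a') v = act a v + act a' v"
    and act_add_right: "act a (v + v') = act a v + act a v'"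
    and act_scale_left: "act (sA [:t:] a) v = map_poly (sM [:t:]) (act a v)"
    and act_scale_right: "act a (sM [:t:] v) = map_poly (sM [:t:]) (act a v)"
    and act_sesquilinear_left:
      "lam_at sM act (var 0) (const (sA [:0, 1:] a)) (const v)
        = pscale sM (- var 0) (lam_at sM act (var 0) (const a) (const v))"
    and act_sesquilinear_right:
      "lam_at sM act (var 0) (const a) (const (sM [:0, 1:] v))
        = pscale sM (del + var 0) (lam_at sM act (var 0) (const a) (const v))"
    and act_bracket:
      "lam_at sM act (var 0) (const a) (lam_at sM act (var 1) (const b) (const v))
          - lam_at sM act (var 1) (const b) (lam_at sM act (var 0) (const a) (const v))
        = lam_at sM act (var 0 + var 1) (lam_at sA br (var 0) (const a) (const b)) (const v)"

section \<open>The basic and the reduced complex\<close>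

text \<open>
  A \<open>q\<close>-cochain is a map on lists of length \<open>q\<close> (and 0 on other lists), \<open>F\<close>-multilinear in the
  entries; its values are polynomials in \<open>\<lambda>\<^sub>0, \<dots>, \<lambda>\<^bsub>q-1\<^esub>\<close>. For \<open>q = 0\<close> such a map
  amounts to the constant polynomial \<open>f []\<close>, an element of \<open>M\<close>.

  \<open>cochain_at s f \<sigma>s as\<close> is the value of \<open>f\<close> at \<open>as\<close>, with the list \<open>\<sigma>s\<close> substituted for the
  formal variables, that is \<open>f\<^bsub>\<sigma>s\<^esub>(as)\<close>. In \<open>cochain_ext s f \<sigma>s u as\<close> the first argument \<open>u\<close> of \<open>f\<close>
  is a polynomial over \<open>A\<close>, its monomials being pulled out.
\<close>

definition vars :: "nat \<Rightarrow> 'a::field poly mpol list"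
  where "vars q = map var [0..<q]"

definition cochain_at ::
    "('a::field poly \<Rightarrow> 'm \<Rightarrow> 'm) \<Rightarrow> ('b list \<Rightarrow> 'm::ab_group_add mpol)
      \<Rightarrow> 'a poly mpol list \<Rightarrow> 'b list \<Rightarrow> 'm mpol"
  where "cochain_at s f \<sigma>s as = psubst s (\<lambda>i. \<sigma>s ! i) (f as)"

definition cochain_ext ::
    "('a::field poly \<Rightarrow> 'm \<Rightarrow> 'm) \<Rightarrow> ('b::zero list \<Rightarrow> 'm::ab_group_add mpol)
      \<Rightarrow> 'a poly mpol list \<Rightarrow> 'b mpol \<Rightarrow> 'b list \<Rightarrow> 'm mpol"
  where "cochain_ext s f \<sigma>s u as =
    (\<Sum>\<alpha>\<in>supp u. pscale s (lmonom \<alpha>) (cochain_at s f \<sigma>s (coef u \<alpha> # as)))"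

definition basic_cochains ::
    "('a::field poly \<Rightarrow> 'b \<Rightarrow> 'b) \<Rightarrow> ('a poly \<Rightarrow> 'm \<Rightarrow> 'm) \<Rightarrow> nat
      \<Rightarrow> ('b::ab_group_add list \<Rightarrow> 'm::ab_group_add mpol) set"
  where "basic_cochains sA sM q = {f.
    (\<forall>as. length as \<noteq> q \<longrightarrow> f as = 0) \<and>
    (\<forall>as. length as = q \<longrightarrow> (\<forall>\<alpha>\<in>supp (f as). supp \<alpha> \<subseteq> {..<q})) \<and>
    (\<forall>as i x y. length as = q \<and> i < q \<longrightarrow>
      f (as[i := x + y]) = f (as[i := x]) + f (as[i := y])) \<and>
    (\<forall>as i c. length as = q \<and> i < q \<longrightarrow>
      f (as[i := sA [:c:] (as ! i)]) = pscale sM (const [:c:]) (f as)) \<and>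
    (\<forall>as i. length as = q \<and> i < q \<longrightarrow>
      f (as[i := sA [:0, 1:] (as ! i)]) = pscale sM (- var i) (f as)) \<and>
    (\<forall>as \<pi>. length as = q \<and> \<pi> permutes {..<q} \<longrightarrow>
      cochain_at sM f (permute_list \<pi> (vars q)) (permute_list \<pi> as)
        = pscale sM (of_int (sign \<pi>)) (f as))}"

text \<open>
  \<open>nths xs (- {k})\<close> omits the entry of index \<open>k\<close>. Counting indices from 0 instead of 1
  turns the sign \<open>(-1)\<^bsup>k+1\<^esup>\<close> into \<open>(-1)\<^bsup>k\<^esup>\<close> and preserves the sign \<open>(-1)\<^bsup>k+l\<^esup>\<close>.
\<close>

definition basic_d ::
    "('a::field poly \<Rightarrow> 'b \<Rightarrow> 'b) \<Rightarrow> ('b \<Rightarrow> 'b \<Rightarrow> 'b poly)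
      \<Rightarrow> ('a poly \<Rightarrow> 'm \<Rightarrow> 'm) \<Rightarrow> ('b \<Rightarrow> 'm \<Rightarrow> 'm poly) \<Rightarrow> nat
      \<Rightarrow> ('b::ab_group_add list \<Rightarrow> 'm::ab_group_add mpol) \<Rightarrow> ('b list \<Rightarrow> 'm mpol)"
  where "basic_d sA br sM act q f = (\<lambda>as. if length as = Suc q then
      (\<Sum>k<Suc q. pscale sM ((-1) ^ k)
        (lam_at sM act (var k) (const (as ! k))
          (cochain_at sM f (nths (vars (Suc q)) (- {k})) (nths as (- {k})))))
      + (\<Sum>l<Suc q. \<Sum>k<l. pscale sM ((-1) ^ (k + l))
        (cochain_ext sM f ((var k + var l) # nths (vars (Suc q)) (- {k, l}))
          (lam_at sA br (var k) (const (as ! k)) (const (as ! l))) (nths as (- {k, l}))))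
    else 0)"

definition cochain_del ::
    "('a::field poly \<Rightarrow> 'm \<Rightarrow> 'm) \<Rightarrow> nat
      \<Rightarrow> ('b list \<Rightarrow> 'm::ab_group_add mpol) \<Rightarrow> ('b list \<Rightarrow> 'm mpol)"
  where "cochain_del sM q f = (\<lambda>as. pscale sM (del + (\<Sum>k<q. var k)) (f as))"

definition basic_complex ::
    "('a::field poly \<Rightarrow> 'b \<Rightarrow> 'b) \<Rightarrow> ('a poly \<Rightarrow> 'm \<Rightarrow> 'm) \<Rightarrow> nat
      \<Rightarrow> ('b::ab_group_add list \<Rightarrow> 'm::ab_group_add mpol) monoid"
  where "basic_complex sA sM q =
    \<lparr>carrier = basic_cochains sA sM q, monoid.mult = (+), one = 0\<rparr>"

definition del_cochains ::
    "('a::field poly \<Rightarrow> 'b \<Rightarrow> 'b) \<Rightarrow> ('a poly \<Rightarrow> 'm \<Rightarrow> 'm) \<Rightarrow> nat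
      \<Rightarrow> ('b::ab_group_add list \<Rightarrow> 'm::ab_group_add mpol) set"
  where "del_cochains sA sM q = cochain_del sM q ` basic_cochains sA sM q"

definition reduced_complex ::
    "('a::field poly \<Rightarrow> 'b \<Rightarrow> 'b) \<Rightarrow> ('a poly \<Rightarrow> 'm \<Rightarrow> 'm) \<Rightarrow> nat
      \<Rightarrow> ('b::ab_group_add list \<Rightarrow> 'm::ab_group_add mpol) set monoid"
  where "reduced_complex sA sM q = basic_complex sA sM q Mod del_cochains sA sM q"

text \<open>
  The map induced on cosets. As \<open>d\<close> commutes with \<open>\<partial>\<close>, all members of the union coincide if
  \<open>X\<close> is an element of the reduced complex.
\<close>

definition reduced_d ::
    "('a::field poly \<Rightarrow> 'b \<Rightarrow> 'b) \<Rightarrow> ('b \<Rightarrow> 'b \<Rightarrow> 'b poly)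
      \<Rightarrow> ('a poly \<Rightarrow> 'm \<Rightarrow> 'm) \<Rightarrow> ('b \<Rightarrow> 'm \<Rightarrow> 'm poly) \<Rightarrow> nat
      \<Rightarrow> ('b::ab_group_add list \<Rightarrow> 'm::ab_group_add mpol) set \<Rightarrow> ('b list \<Rightarrow> 'm mpol) set"
  where "reduced_d sA br sM act q X =
    (\<Union>f\<in>X. del_cochains sA sM (Suc q) #>\<^bsub>basic_complex sA sM (Suc q)\<^esub> basic_d sA br sM act q f)"

text \<open>Cohomology in degree \<open>q\<close> of a complex \<open>G 0 \<rightarrow> G 1 \<rightarrow> \<dots>\<close> of abelian groups.\<close>

definition cohomology :: "(nat \<Rightarrow> 'c monoid) \<Rightarrow> (nat \<Rightarrow> 'c \<Rightarrow> 'c) \<Rightarrow> nat \<Rightarrow> 'c set monoid"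
  where "cohomology G d q =
    (G q)\<lparr>carrier := kernel (G q) (G (Suc q)) (d q)\<rparr>
      Mod (case q of 0 \<Rightarrow> {one (G 0)} | Suc p \<Rightarrow> d p ` carrier (G p))"

definition basic_cohomology ::
    "('a::field poly \<Rightarrow> 'b \<Rightarrow> 'b) \<Rightarrow> ('b \<Rightarrow> 'b \<Rightarrow> 'b poly)
      \<Rightarrow> ('a poly \<Rightarrow> 'm \<Rightarrow> 'm) \<Rightarrow> ('b \<Rightarrow> 'm \<Rightarrow> 'm poly) \<Rightarrow> nat
      \<Rightarrow> ('b::ab_group_add list \<Rightarrow> 'm::ab_group_add mpol) set monoid"
  where "basic_cohomology sA br sM act q = cohomology (basic_complex sA sM) (basic_d sA br sM act) q"

definition reduced_cohomology ::
    "('a::field poly \<Rightarrow> 'b \<Rightarrow> 'b) \<Rightarrow> ('b \<Rightarrow> 'b \<Rightarrow> 'b poly)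
      \<Rightarrow> ('a poly \<Rightarrow> 'm \<Rightarrow> 'm) \<Rightarrow> ('b \<Rightarrow> 'm \<Rightarrow> 'm poly) \<Rightarrow> nat
      \<Rightarrow> ('b::ab_group_add list \<Rightarrow> 'm::ab_group_add mpol) set set monoid"
  where "reduced_cohomology sA br sM act q =
    cohomology (reduced_complex sA sM) (reduced_d sA br sM act) q"

section \<open>The algebra \<open>W(0)\<close> and its modules of rank one\<close>

definition is_W0 ::
    "('a::field poly \<Rightarrow> 'b::ab_group_add \<Rightarrow> 'b) \<Rightarrow> ('b \<Rightarrow> 'b \<Rightarrow> 'b poly) \<Rightarrow> 'b \<Rightarrow> 'b \<Rightarrow> bool"
  where "is_W0 sA br L H \<longleftrightarrow>
    lie_conformal_algebra sA br \<and> L \<noteq> H \<and> free_on sA {L, H} \<and>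
    br L L = [: sA [:0, 1:] L, sA [:2:] L :] \<and>
    br L H = [: sA [:0, 1:] H, H :] \<and>
    br H L = [: 0, H :] \<and>
    br H H = 0"

definition is_M0 ::
    "('a::field poly \<Rightarrow> 'b::ab_group_add \<Rightarrow> 'b) \<Rightarrow> ('b \<Rightarrow> 'b \<Rightarrow> 'b poly) \<Rightarrow> 'b \<Rightarrow> 'b
      \<Rightarrow> ('a poly \<Rightarrow> 'm::ab_group_add \<Rightarrow> 'm) \<Rightarrow> ('b \<Rightarrow> 'm \<Rightarrow> 'm poly) \<Rightarrow> 'm \<Rightarrow> 'a \<Rightarrow> 'a \<Rightarrow> bool"
  where "is_M0 sA br L H sM act m \<Delta> \<beta> \<longleftrightarrow>
    lca_module sA br sM act \<and> free_on sM {m} \<and>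
    act L m = [: sM [:0, 1:] m, sM [:\<Delta>:] m :] \<and>
    act H m = [: sM [:\<beta>:] m :]"

end

theory Submission
  imports Defs
begin

text \<open>
  Both complexes are contractible. At \<open>\<lambda> = 0\<close> the generator \<open>H\<close> acts on the module as the nonzero
  scalar \<open>\<beta>\<close>, and \<open>[H\<^sub>0 a] = 0\<close> for every \<open>a\<close> in the algebra. Consider the contraction
  \<open>(\<iota> f)(a\<^sub>1, \<dots>) = f\<^bsub>0,\<lambda>\<^sub>1,\<dots>\<^esub>(H, a\<^sub>1, \<dots>)\<close>. Cartan's formula states that \<open>d \<iota> + \<iota> d\<close> is the Lie
  derivative along \<open>H\<close> at \<open>\<lambda> = 0\<close>, which sends \<open>f\<close> to
  \<open>H\<^sub>0 f(a\<^sub>1, \<dots>) - \<Sum>i. f(a\<^sub>1, \<dots>, [H\<^sub>0 a\<^sub>i], \<dots>)\<close>. Here it is multiplication by \<open>\<beta>\<close>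
  (\<open>lie_derivative_zero_mode\<close>), so \<open>\<beta>\<^sup>-\<^sup>1 \<iota>\<close> is a contracting homotopy (\<open>homotopy\<close>, \<open>homotopy_0\<close>) and every
  cocycle is a coboundary. The variable inserted by \<open>\<iota>\<close> is 0, hence \<open>\<iota>\<close> commutes with multiplication
  by \<open>\<partial> + \<Sum>k. \<lambda>\<^sub>k\<close> (\<open>contraction_del\<close>), and the homotopy descends to the reduced complex.

  The formula for \<open>d\<close> with omitted indices is awkward to manipulate, so Cartan's formula is turned
  into a definition. A cochain \<open>f\<close> is viewed as a function \<open>\<Phi>\<close> of lists of pairs \<open>(\<sigma>, a)\<close>, with
  \<open>\<Phi> [(\<sigma>\<^sub>1, a\<^sub>1), \<dots>] = f\<^bsub>\<sigma>\<^sub>1,\<dots>\<^esub>(a\<^sub>1, \<dots>)\<close> (\<open>eval_cochain\<close>), and \<open>cartan_d\<close> is defined by the recursion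
  \<open>(d \<Phi>)(x # xs) = (\<theta>\<^sub>x \<Phi>)(xs) - (d (\<Phi> (x # \<cdot>)))(xs)\<close>, where \<open>\<theta>\<^sub>x\<close> is the Lie derivative along \<open>x\<close>.
  Skew-symmetry, sesquilinearity, compatibility with substitutions and commutation with \<open>\<partial>\<close> are then
  inductions on the list (\<open>alternating_cartan_d\<close>, \<open>sesquilinear_at_cartan_d\<close>, \<open>psubst_cartan_d\<close>,
  \<open>cartan_d_del\<close>), and the homotopy formula is the recursion itself at \<open>x = (0, H)\<close>. The recursion
  unfolds to the formula with omitted indices (\<open>cartan_d_eq_sum\<close>, \<open>basic_d_eq\<close>).
\<close>

section \<open>Polynomials with coefficients in a module\<close>

lemma mpol_induct [case_names single add]:
  assumes "\<And>\<alpha> v. P (Poly_Mapping.single \<alpha> v)"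
    and "\<And>p q. P p \<Longrightarrow> P q \<Longrightarrow> P (p + q)"
  shows "P (p :: 'i \<Rightarrow>\<^sub>0 'c::ab_group_add)"
proof (induction p rule: Poly_Mapping.update_induct)
  case const
  show ?case using assms(1)[of _ 0] by simp
next
  case (update p \<alpha> v)
  have "Poly_Mapping.update \<alpha> v p = p + Poly_Mapping.single \<alpha> v"
    using update(1)
    by (intro poly_mapping_eqI)
       (auto simp: lookup_update lookup_add lookup_single when_def in_keys_iff)
  then show ?case using assms update by simp
qed

text \<open>
  Polynomials over a module are generated by their monomials under addition, so an identity between
  additive maps is checked on monomials. Most identities below are proved in this way.
\<close>

lemma additive_ext:
  assumes "additive F" "additive G"
    and "\<And>\<alpha> v. F (Poly_Mapping.single \<alpha> v) = G (Poly_Mapping.single \<alpha> v)"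
  shows "F (p :: 'i \<Rightarrow>\<^sub>0 'c::ab_group_add) = G p"
  by (induction p rule: mpol_induct) (simp_all add: assms additive.add)

definition lsum :: "('i \<Rightarrow> 'c \<Rightarrow> 'd) \<Rightarrow> ('i \<Rightarrow>\<^sub>0 'c::zero) \<Rightarrow> 'd::ab_group_add"
  where "lsum g p = (\<Sum>\<alpha>\<in>supp p. g \<alpha> (coef p \<alpha>))"

lemma additive_lsum:
  fixes g :: "'i \<Rightarrow> 'c::ab_group_add \<Rightarrow> 'd::ab_group_add"
  assumes "\<And>\<alpha>. additive (g \<alpha>)"
  shows "additive (lsum g)"
proof
  fix p q :: "'i \<Rightarrow>\<^sub>0 'c"
  show "lsum g (p + q) = lsum g p + lsum g q"
    unfolding lsum_def
    by (rule setsum_keys_plus_distrib) (simp_all add: assms additive.zero additive.add)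
qed

lemma lsum_single:
  assumes "additive (g \<alpha>)"
  shows "lsum g (Poly_Mapping.single \<alpha> v) = g \<alpha> v"
  by (auto simp: lsum_def additive.zero[OF assms])

lemma additive_compose: "additive F \<Longrightarrow> additive G \<Longrightarrow> additive (\<lambda>x. F (G x))"
  by (simp add: additive_def)

lemma additive_plus: "additive F \<Longrightarrow> additive G \<Longrightarrow> additive (\<lambda>x. F x + G x)"
  by (simp add: additive_def algebra_simps)

lemma additive_sum: "(\<And>i. i \<in> I \<Longrightarrow> additive (F i)) \<Longrightarrow> additive (\<lambda>x. \<Sum>i\<in>I. F i x)"
  by (simp add: additive_def sum.distrib)

lemma additive_single: "additive (Poly_Mapping.single \<alpha>)"
  by (simp add: additive_def single_add)

lemma additive_const: "additive const"
  by (simp add: additive_def const_def single_add)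

definition mpow :: "(nat \<Rightarrow> 'r::comm_ring_1) \<Rightarrow> (nat \<Rightarrow>\<^sub>0 nat) \<Rightarrow> 'r"
  where "mpow \<sigma> \<alpha> = (\<Prod>i\<in>supp \<alpha>. \<sigma> i ^ coef \<alpha> i)"

lemma mpow_superset: "finite I \<Longrightarrow> supp \<alpha> \<subseteq> I \<Longrightarrow> mpow \<sigma> \<alpha> = (\<Prod>i\<in>I. \<sigma> i ^ coef \<alpha> i)"
  unfolding mpow_def by (rule prod.mono_neutral_left) (auto simp: in_keys_iff)

lemma mpow_0 [simp]: "mpow \<sigma> 0 = 1"
  by (simp add: mpow_def)

lemma mpow_single [simp]: "mpow \<sigma> (Poly_Mapping.single i n) = \<sigma> i ^ n"
  by (simp add: mpow_def)

lemma mpow_add: "mpow \<sigma> (\<alpha> + \<beta>) = mpow \<sigma> \<alpha> * mpow \<sigma> \<beta>"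
proof -
  let ?I = "supp \<alpha> \<union> supp \<beta>"
  have "supp (\<alpha> + \<beta>) \<subseteq> ?I" by (rule Poly_Mapping.keys_add)
  then show ?thesis
    by (simp add: mpow_superset[of ?I] lookup_add power_add prod.distrib)
qed

lemma lmonom_add: "lmonom (\<alpha> + \<beta>) = lmonom \<alpha> * lmonom \<beta>"
  by (simp add: lmonom_def mult_single)

lemma lmonom_0 [simp]: "lmonom 0 = 1"
  by (simp add: lmonom_def)

lemma lmonom_multiple: "lmonom (Poly_Mapping.single i n) = var i ^ n"
proof (induction n)
  case (Suc n)
  then show ?case
    using lmonom_add[of "Poly_Mapping.single i n" "Poly_Mapping.single i 1"]
    unfolding single_add[symmetric] power_Suc Suc(1)[symmetric] by (simp add: var_def mult.commute)
qed simp

lemma mpow_var [simp]: "mpow var \<alpha> = (lmonom \<alpha> :: 'a::field poly mpol)"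
proof -
  let ?m = "lmonom :: (nat \<Rightarrow>\<^sub>0 nat) \<Rightarrow> 'a poly mpol"
  have *: "?m (\<Sum>i\<in>I. \<gamma> i) = (\<Prod>i\<in>I. ?m (\<gamma> i))" if "finite I" for I and \<gamma> :: "nat \<Rightarrow> nat \<Rightarrow>\<^sub>0 nat"
    using that by (induction I) (simp_all add: lmonom_add)
  have "(\<Sum>i\<in>supp \<alpha>. Poly_Mapping.single i (coef \<alpha> i)) = \<alpha>"
    by (intro poly_mapping_eqI) (auto simp: lookup_sum lookup_single when_def in_keys_iff)
  then have "?m \<alpha> = (\<Prod>i\<in>supp \<alpha>. ?m (Poly_Mapping.single i (coef \<alpha> i)))"
    using *[of "supp \<alpha>" "\<lambda>i. Poly_Mapping.single i (coef \<alpha> i)"] by simp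
  then show ?thesis by (simp add: mpow_def lmonom_multiple)
qed

lemma mpow_cong: "(\<And>i. i \<in> supp \<alpha> \<Longrightarrow> \<sigma> i = \<tau> i) \<Longrightarrow> mpow \<sigma> \<alpha> = mpow \<tau> \<alpha>"
  by (simp add: mpow_def)

locale mpol_module = module s
  for s :: "'a::field poly \<Rightarrow> 'm::ab_group_add \<Rightarrow> 'm"
begin

lemma additive_scale: "additive (s c)"
  by (simp add: additive_def scale_right_distrib)

lemma pscale_lsum:
  "pscale s r v = lsum (\<lambda>\<alpha> c. lsum (\<lambda>\<beta> w. Poly_Mapping.single (\<alpha> + \<beta>) (s c w)) v) r"
  by (simp add: pscale_def lsum_def)

lemma
  shows additive_pscale_left: "additive (\<lambda>r. pscale s r v)"
    and additive_pscale: "additive (pscale s r)"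
    and pscale_single: "pscale s (Poly_Mapping.single \<alpha> c) (Poly_Mapping.single \<beta> w)
           = Poly_Mapping.single (\<alpha> + \<beta>) (s c w)"
proof -
  have 1: "additive (\<lambda>w. Poly_Mapping.single (\<alpha> + \<beta>) (s c w))" for \<alpha> \<beta> c
    by (intro additive_compose[OF additive_single] additive_scale)
  have 2: "additive (\<lambda>c. lsum (\<lambda>\<beta> w. Poly_Mapping.single (\<alpha> + \<beta>) (s c w)) v)" for \<alpha> v
    unfolding lsum_def
    by (intro additive_sum) (simp add: additive_def single_add scale_left_distrib)
  show "additive (\<lambda>r. pscale s r v)"
    unfolding pscale_lsum by (rule additive_lsum) (rule 2)
  show "additive (pscale s r)"
    unfolding pscale_lsum lsum_def[where p = r] by (intro additive_sum additive_lsum 1)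
  show "pscale s (Poly_Mapping.single \<alpha> c) (Poly_Mapping.single \<beta> w)
           = Poly_Mapping.single (\<alpha> + \<beta>) (s c w)"
    unfolding pscale_lsum by (subst lsum_single, rule 2, rule lsum_single, rule 1)
qed

lemma pscale_pscale: "pscale s r (pscale s r' v) = pscale s (r * r') v"
proof (rule additive_ext[where F = "\<lambda>v. pscale s r (pscale s r' v)"])
  show "additive (\<lambda>v. pscale s r (pscale s r' v))"
    by (intro additive_compose[OF additive_pscale] additive_pscale)
  show "additive (pscale s (r * r'))" by (rule additive_pscale)
  fix \<gamma> w
  show "pscale s r (pscale s r' (Poly_Mapping.single \<gamma> w))
      = pscale s (r * r') (Poly_Mapping.single \<gamma> w)"
  proof (induction r rule: mpol_induct)
    case (single \<alpha> c)
    show ?case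
      by (induction r' rule: mpol_induct)
         (simp_all add: pscale_single mult_single add.assoc additive.add[OF additive_pscale]
           additive.add[OF additive_pscale_left] distrib_left)
  qed (simp add: additive.add[OF additive_pscale_left] distrib_right)
qed

lemma pscale_one: "pscale s 1 v = v"
proof (induction v rule: mpol_induct)
  case (single \<alpha> v)
  show ?case using pscale_single[of 0 1 \<alpha> v] by simp
qed (simp add: additive.add[OF additive_pscale])

sublocale P: module "pscale s"
  by standard
     (simp_all add: additive.add[OF additive_pscale] additive.add[OF additive_pscale_left]
       pscale_pscale pscale_one)

lemma pscale_const: "pscale s (const c) (const v) = const (s c v)"
  using pscale_single[of 0 c 0 v] by (simp add: const_def)

lemma single_eq: "Poly_Mapping.single \<alpha> v = pscale s (lmonom \<alpha>) (const v)"
  using pscale_single[of \<alpha> 1 0 v] by (simp add: const_def lmonom_def)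

end

lemma module_mult: "module ((*) :: 'a::field poly \<Rightarrow> _)"
  by standard (simp_all add: algebra_simps)

interpretation R: mpol_module "(*)"
  by (rule mpol_module.intro, rule module_mult)

text \<open>
  For the regular module, scalar multiplication of polynomials is the product of the polynomial ring,
  and substitution is a ring endomorphism. This makes the lemmas on modules available for the
  polynomials that are being substituted.
\<close>

lemma pscale_times: "pscale (*) r p = r * p"
proof (rule additive_ext[where F = "pscale (*) r"])
  show "additive (pscale (*) r)" by (rule R.additive_pscale)
  show "additive ((*) r)" by (simp add: additive_def distrib_left)
  fix \<gamma> w
  show "pscale (*) r (Poly_Mapping.single \<gamma> w) = r * Poly_Mapping.single \<gamma> w"
    by (induction r rule: mpol_induct)
       (simp_all add: R.pscale_single mult_single additive.add[OF R.additive_pscale_left]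
         distrib_right)
qed

section \<open>Substitution\<close>

abbreviation rsubst :: "(nat \<Rightarrow> 'a::field poly mpol) \<Rightarrow> 'a poly mpol \<Rightarrow> 'a poly mpol"
  where "rsubst \<equiv> psubst (*)"

context mpol_module
begin

lemma psubst_lsum: "psubst s \<sigma> p = lsum (\<lambda>\<alpha> v. pscale s (mpow \<sigma> \<alpha>) (const v)) p"
  by (simp add: psubst_def lsum_def mpow_def)

lemma additive_psubst: "additive (psubst s \<sigma>)"
  unfolding psubst_lsum
  by (intro additive_lsum additive_compose[OF additive_pscale] additive_const)

lemma psubst_single: "psubst s \<sigma> (Poly_Mapping.single \<alpha> v) = pscale s (mpow \<sigma> \<alpha>) (const v)"
  unfolding psubst_lsum
  by (intro lsum_single additive_compose[OF additive_pscale] additive_const)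

lemma psubst_const [simp]: "psubst s \<sigma> (const v) = const v"
  using psubst_single[of \<sigma> 0 v] by (simp add: const_def)

lemmas psubst_add = additive.add[OF additive_psubst]
  and psubst_minus = additive.minus[OF additive_psubst]
  and psubst_diff = additive.diff[OF additive_psubst]
  and psubst_0 [simp] = additive.zero[OF additive_psubst]
  and psubst_sum = additive.sum[OF additive_psubst]

lemma psubst_var [simp]: "psubst s var p = p"
  by (rule additive_ext[OF additive_psubst, of "\<lambda>p. p"])
     (simp_all add: additive_def psubst_single flip: single_eq)

end

context mpol_module
begin

text \<open>
  Substitution is semilinear over the ring endomorphism that it induces on the scalars.
\<close>

lemma psubst_pscale: "psubst s \<sigma> (pscale s r p) = pscale s (rsubst \<sigma> r) (psubst s \<sigma> p)"
proof (rule additive_ext[where F = "\<lambda>p. psubst s \<sigma> (pscale s r p)"])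
  show "additive (\<lambda>p. psubst s \<sigma> (pscale s r p))"
    by (intro additive_compose[OF additive_psubst] additive_pscale)
  show "additive (\<lambda>p. pscale s (rsubst \<sigma> r) (psubst s \<sigma> p))"
    by (intro additive_compose[OF additive_pscale] additive_psubst)
  fix \<beta> w
  show "psubst s \<sigma> (pscale s r (Poly_Mapping.single \<beta> w))
      = pscale s (rsubst \<sigma> r) (psubst s \<sigma> (Poly_Mapping.single \<beta> w))"
  proof (induction r rule: mpol_induct)
    case (single \<alpha> c)
    show ?case
      by (simp add: pscale_single psubst_single R.psubst_single pscale_times mpow_add
          flip: pscale_const) (simp add: mult_ac)
  next
    case (add r r')
    then show ?case
      by (simp add: P.scale_left_distrib psubst_add R.psubst_add)
  qed
qed

end

lemma rsubst_mult: "rsubst \<sigma> (r * r') = rsubst \<sigma> r * rsubst \<sigma> r'"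
  using R.psubst_pscale[of \<sigma> r r'] by (simp add: pscale_times)

lemma const_1 [simp]: "const 1 = 1"
  by (simp add: const_def)

lemma rsubst_1 [simp]: "rsubst \<sigma> 1 = 1"
  using R.psubst_const[of \<sigma> 1] by simp

lemma rsubst_power: "rsubst \<sigma> (r ^ n) = rsubst \<sigma> r ^ n"
  by (induction n) (simp_all add: rsubst_mult)

lemma rsubst_var [simp]: "rsubst \<sigma> (var i) = \<sigma> i"
  by (simp add: var_def lmonom_def R.psubst_single pscale_times)

lemma rsubst_del [simp]: "rsubst \<sigma> del = del"
  by (simp add: del_def)

lemma rsubst_mpow: "rsubst \<sigma> (mpow \<tau> \<alpha>) = mpow (\<lambda>i. rsubst \<sigma> (\<tau> i)) \<alpha>"
proof -
  have "rsubst \<sigma> (\<Prod>i\<in>I. f i) = (\<Prod>i\<in>I. rsubst \<sigma> (f i))" if "finite I"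
    for I :: "nat set" and f
    using that by (induction I) (simp_all add: rsubst_mult)
  then show ?thesis by (simp add: mpow_def rsubst_power)
qed

lemma rsubst_lmonom [simp]: "rsubst \<sigma> (lmonom \<alpha>) = mpow \<sigma> \<alpha>"
  using rsubst_mpow[of \<sigma> var \<alpha>] by simp

context mpol_module
begin

lemma psubst_psubst: "psubst s \<sigma> (psubst s \<tau> p) = psubst s (\<lambda>i. rsubst \<sigma> (\<tau> i)) p"
  by (rule additive_ext[where F = "\<lambda>p. psubst s \<sigma> (psubst s \<tau> p)"])
     (simp_all add: additive_compose[OF additive_psubst additive_psubst] additive_psubst
       psubst_single psubst_pscale rsubst_mpow)

lemma psubst_cong:
  assumes "\<And>\<alpha>. \<alpha> \<in> supp p \<Longrightarrow> supp \<alpha> \<subseteq> I" "\<And>i. i \<in> I \<Longrightarrow> \<sigma> i = \<tau> i"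
  shows "psubst s \<sigma> p = psubst s \<tau> p"
  unfolding psubst_lsum lsum_def
  by (intro sum.cong refl arg_cong2[where f = "pscale s"] mpow_cong) (use assms in blast)

text \<open>
  Substituting 0 for the variables outside \<open>I\<close> deletes the monomials in which such a variable occurs.
  This turns the bound on the variables of a cochain into a statement on substitutions.
\<close>

lemma supp_subset_if_psubst_eq:
  assumes "psubst s (\<lambda>i. if i \<in> I then var i else 0) p = p" "\<alpha> \<in> supp p"
  shows "supp \<alpha> \<subseteq> I"
proof (rule ccontr)
  let ?\<tau> = "\<lambda>i. if i \<in> I then var i else 0 :: 'a poly mpol"
  assume *: "\<not> supp \<alpha> \<subseteq> I"
  have "coef (psubst s ?\<tau> q) \<alpha> = 0" for q :: "'m mpol"
  proof (induction q rule: mpol_induct)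
    case (single \<gamma> v)
    show ?case
    proof (cases "supp \<gamma> \<subseteq> I")
      case True
      then have "mpow ?\<tau> \<gamma> = mpow var \<gamma>" by (intro mpow_cong) auto
      then have "psubst s ?\<tau> (Poly_Mapping.single \<gamma> v) = Poly_Mapping.single \<gamma> v"
        by (simp only: psubst_single mpow_var flip: single_eq)
      moreover have "\<gamma> \<noteq> \<alpha>" using * True by blast
      ultimately show ?thesis by (simp add: lookup_single)
    next
      case False
      then obtain i where "i \<in> supp \<gamma>" "i \<notin> I" by blast
      then have "mpow ?\<tau> \<gamma> = 0"
        unfolding mpow_def
        by (intro prod_zero finite_keys bexI[of _ i]) (simp_all add: in_keys_iff)
      then show ?thesis by (simp add: psubst_single)
    qed
  qed (simp add: psubst_add lookup_add)
  from this[of p] show False using assms by (simp add: in_keys_iff)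
qed

end

section \<open>Conformal products\<close>

text \<open>
  The polynomials in the \<open>\<lambda>\<^sub>i\<close> with coefficients in \<open>F\<close>. A \<open>\<lambda>\<close>-action commutes with multiplication by
  these, but not with \<open>\<partial>\<close>, which it shifts by \<open>\<lambda>\<close>. The generators are listed because that commutation
  is proved by induction on them.
\<close>

inductive del_free :: "'a::field poly mpol \<Rightarrow> bool" where
  const: "del_free (const [:c:])"
| var: "del_free (var i)"
| add: "del_free r \<Longrightarrow> del_free r' \<Longrightarrow> del_free (r + r')"
| mult: "del_free r \<Longrightarrow> del_free r' \<Longrightarrow> del_free (r * r')"

lemma del_free_0 [simp]: "del_free 0"
  using del_free.const[of 0] by (simp add: const_def)

lemma del_free_1 [simp]: "del_free 1"
  using del_free.const[of 1] by (simp flip: one_pCons)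

lemma const_minus_1: "const [:- 1:] = (- 1 :: 'a::field poly mpol)"
proof -
  have "const [:- 1:] = const (- (1 :: 'a poly))"
    by (simp add: one_pCons)
  then show ?thesis
    by (simp only: additive.minus[OF additive_const] const_1)
qed

lemma del_free_minus: "del_free r \<Longrightarrow> del_free (- r)"
  using del_free.mult[OF del_free.const[of "- 1"], of r] by (simp add: const_minus_1)

lemma del_free_mpow:
  assumes "\<And>i. del_free (\<tau> i)"
  shows "del_free (mpow \<tau> \<alpha>)"
proof -
  have power: "del_free (\<tau> i ^ n)" for i n
    by (induction n) (simp_all add: assms del_free.mult)
  have "del_free (\<Prod>i\<in>I. \<tau> i ^ coef \<alpha> i)" if "finite I" for I
    using that by (induction I) (simp_all add: power del_free.mult)
  then show ?thesis by (simp add: mpow_def)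
qed

context mpol_module
begin

text \<open>
  The value at \<open>\<sigma>\<close> of a bracket or of an action, with \<open>\<partial>\<close> moved to the left.
\<close>

definition peval :: "'a poly mpol \<Rightarrow> 'm poly \<Rightarrow> 'm mpol"
  where "peval \<sigma> P = (\<Sum>n\<le>degree P. pscale s (\<sigma> ^ n) (const (coeff P n)))"

lemma const_0 [simp]: "const 0 = 0"
  by (simp add: const_def)

lemma peval_upto:
  "degree P \<le> N \<Longrightarrow> peval \<sigma> P = (\<Sum>n\<le>N. pscale s (\<sigma> ^ n) (const (coeff P n)))"
  unfolding peval_def
  by (rule sum.mono_neutral_left) (auto simp: coeff_eq_0)

lemma additive_peval: "additive (peval \<sigma>)"
proof
  fix P Q :: "'m poly"
  let ?N = "max (degree P) (degree Q)"
  show "peval \<sigma> (P + Q) = peval \<sigma> P + peval \<sigma> Q"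
    by (simp add: peval_upto[of _ ?N] degree_add_le additive.add[OF additive_const]
        P.scale_right_distrib sum.distrib)
qed

lemma peval_map:
  "peval \<sigma> (map_poly (s [:c:]) P) = pscale s (const [:c:]) (peval \<sigma> P)"
proof -
  have "degree (map_poly (s [:c:]) P) \<le> degree P"
    by (intro degree_le) (simp add: coeff_map_poly coeff_eq_0)
  then show ?thesis
    by (simp add: peval_upto[of _ "degree P"] coeff_map_poly P.scale_sum_right mult.commute
        flip: pscale_const)
qed

lemma psubst_peval: "psubst s \<tau> (peval \<sigma> P) = peval (rsubst \<tau> \<sigma>) P"
  by (simp add: peval_def psubst_sum psubst_pscale rsubst_power)

lemma peval_0: "peval 0 P = const (coeff P 0)"
proof -
  have "peval 0 P = (\<Sum>n\<in>{0}. pscale s (0 ^ n) (const (coeff P n)))"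
    unfolding peval_def by (rule sum.mono_neutral_right) (auto simp: power_0_left split: if_splits)
  then show ?thesis by simp
qed

end

text \<open>
  The properties shared by the \<open>\<lambda>\<close>-bracket and the \<open>\<lambda>\<close>-action of a module, so that the extension to
  polynomial arguments and to arbitrary \<open>\<sigma>\<close> in place of \<open>\<lambda>\<close> is studied once.
\<close>

locale conformal_product = mpol_module s
  for s :: "'a::field poly \<Rightarrow> 'm::ab_group_add \<Rightarrow> 'm" +
  fixes sA :: "'a poly \<Rightarrow> 'b::ab_group_add \<Rightarrow> 'b"
    and op :: "'b \<Rightarrow> 'm \<Rightarrow> 'm poly"
  assumes op_add_left: "op (a + a') v = op a v + op a' v"
    and op_add_right: "op a (v + v') = op a v + op a v'"
    and op_scale_left: "op (sA [:t:] a) v = map_poly (s [:t:]) (op a v)"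
    and op_scale_right: "op a (s [:t:] v) = map_poly (s [:t:]) (op a v)"
    and op_sesquilinear_left:
      "lam_at s op (var 0) (const (sA [:0, 1:] a)) (const v)
        = pscale s (- var 0) (lam_at s op (var 0) (const a) (const v))"
    and op_sesquilinear_right:
      "lam_at s op (var 0) (const a) (const (s [:0, 1:] v))
        = pscale s (del + var 0) (lam_at s op (var 0) (const a) (const v))"
begin

lemma op_0 [simp]: "op 0 v = 0" "op a 0 = 0"
  using op_add_left[of 0 0 v] op_add_right[of a 0 0] by simp_all

lemma additive_term: "additive (\<lambda>w. pscale s (lmonom \<beta>) (peval \<sigma> (op a w)))"
  by (intro additive_compose[OF additive_pscale] additive_compose[OF additive_peval])
     (simp add: additive_def op_add_right)

lemma lam_at_lsum:
  "lam_at s op \<sigma> (const a) v = lsum (\<lambda>\<beta> w. pscale s (lmonom \<beta>) (peval \<sigma> (op a w))) v"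
proof (cases "a = 0")
  case True
  then show ?thesis
    by (simp add: lam_at_def lsum_def additive.zero[OF additive_peval])
next
  case False
  then have "supp (const a) = {0}" "coef (const a) 0 = a" by (simp_all add: const_def)
  then show ?thesis
    by (simp add: lam_at_def lsum_def peval_def P.scale_sum_right)
qed

lemma lam_at_single:
  "lam_at s op \<sigma> (const a) (Poly_Mapping.single \<beta> w) = pscale s (lmonom \<beta>) (peval \<sigma> (op a w))"
  unfolding lam_at_lsum by (rule lsum_single) (rule additive_term)

lemma lam_at_const: "lam_at s op \<sigma> (const a) (const v) = peval \<sigma> (op a v)"
  using lam_at_single[of \<sigma> a 0 v] by (simp add: const_def)

lemma additive_lam_at: "additive (lam_at s op \<sigma> (const a))"
  unfolding lam_at_lsum by (intro additive_lsum additive_term)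

lemmas lam_at_add = additive.add[OF additive_lam_at]

lemma lam_at_del_free:
  assumes "del_free r"
  shows "lam_at s op \<sigma> (const a) (pscale s r v) = pscale s r (lam_at s op \<sigma> (const a) v)"
  using assms
proof (induction r arbitrary: v)
  case (const c)
  show ?case
  proof (induction v rule: mpol_induct)
    case (single \<beta> w)
    have "pscale s (const [:c:]) (Poly_Mapping.single \<beta> w) = Poly_Mapping.single \<beta> (s [:c:] w)"
      using pscale_single[of 0 "[:c:]" \<beta> w] by (simp add: const_def)
    then show ?case by (simp add: lam_at_single op_scale_right peval_map mult.commute)
  qed (simp add: P.scale_right_distrib lam_at_add)
next
  case (var i)
  show ?case
  proof (induction v rule: mpol_induct)
    case (single \<beta> w)
    have "pscale s (var i) (Poly_Mapping.single \<beta> w)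
        = Poly_Mapping.single (Poly_Mapping.single i 1 + \<beta>) w"
      using pscale_single[of "Poly_Mapping.single i 1" 1 \<beta> w] by (simp add: var_def lmonom_def)
    then show ?case by (simp add: lam_at_single lmonom_add var_def)
  qed (simp add: P.scale_right_distrib lam_at_add)
next
  case (add r r')
  then show ?case by (simp add: P.scale_left_distrib lam_at_add)
next
  case (mult r r')
  then show ?case by (simp only: pscale_pscale[symmetric])
qed

lemma psubst_lam_at:
  assumes "\<And>i. del_free (\<tau> i)"
  shows "psubst s \<tau> (lam_at s op \<sigma> (const a) v)
       = lam_at s op (rsubst \<tau> \<sigma>) (const a) (psubst s \<tau> v)"
proof (induction v rule: mpol_induct)
  case (single \<beta> w)
  show ?case
    by (simp add: lam_at_single psubst_single lam_at_del_free del_free_mpow assms lam_at_const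
        psubst_pscale psubst_peval)
qed (simp add: psubst_add lam_at_add)

text \<open>
  The sesquilinearity axioms are stated at the variable \<open>\<lambda>\<^sub>0\<close>; substituting \<open>\<sigma>\<close> for it gives them at
  any \<open>\<sigma>\<close>.
\<close>

lemma peval_op_del_left: "peval \<sigma> (op (sA [:0, 1:] a) v) = pscale s (- \<sigma>) (peval \<sigma> (op a v))"
  using arg_cong[OF op_sesquilinear_left, of "psubst s (\<lambda>_. \<sigma>)" a v]
  by (simp add: lam_at_const psubst_pscale psubst_peval psubst_minus)

lemma peval_op_del_right:
  "peval \<sigma> (op a (s [:0, 1:] v)) = pscale s (del + \<sigma>) (peval \<sigma> (op a v))"
  using arg_cong[OF op_sesquilinear_right, of "psubst s (\<lambda>_. \<sigma>)" a v]
  by (simp add: lam_at_const psubst_pscale psubst_peval R.psubst_add)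

lemma lam_at_del_left:
  "lam_at s op \<sigma> (const (sA [:0, 1:] a)) v = pscale s (- \<sigma>) (lam_at s op \<sigma> (const a) v)"
proof (induction v rule: mpol_induct)
  case (single \<beta> w)
  show ?case by (simp add: lam_at_single peval_op_del_left mult.commute)
next
  case (add p q)
  then show ?case by (simp add: lam_at_add P.scale_right_distrib del: P.scale_minus_left)
qed

lemma lam_at_scale_left:
  "lam_at s op \<sigma> (const (sA [:c:] a)) v = pscale s (const [:c:]) (lam_at s op \<sigma> (const a) v)"
proof (induction v rule: mpol_induct)
  case (single \<beta> w)
  show ?case by (simp add: lam_at_single op_scale_left peval_map mult.commute)
qed (simp add: lam_at_add P.scale_right_distrib)

lemma lam_at_add_left:
  "lam_at s op \<sigma> (const (a + a')) v = lam_at s op \<sigma> (const a) v + lam_at s op \<sigma> (const a') v"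
proof (induction v rule: mpol_induct)
  case (single \<beta> w)
  show ?case
    by (simp add: lam_at_single op_add_left additive.add[OF additive_peval] P.scale_right_distrib)
qed (simp add: lam_at_add)

lemma lam_at_del_right:
  "lam_at s op \<sigma> (const a) (pscale s del v) = pscale s (del + \<sigma>) (lam_at s op \<sigma> (const a) v)"
proof (induction v rule: mpol_induct)
  case (single \<beta> w)
  have "pscale s del (Poly_Mapping.single \<beta> w) = Poly_Mapping.single \<beta> (s [:0, 1:] w)"
    using pscale_single[of 0 "[:0, 1:]" \<beta> w] by (simp add: del_def const_def)
  then show ?case by (simp add: lam_at_single peval_op_del_right mult.commute)
qed (simp add: lam_at_add P.scale_right_distrib)

end

sublocale lie_conformal_algebra \<subseteq> br: conformal_product sA sA br
  by unfold_locales
     (simp_all only: br_add_left br_add_right br_scale_left br_scale_right br_sesquilinear_left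
       br_sesquilinear_right)

sublocale lca_module \<subseteq> act: conformal_product sM sA act
  by unfold_locales
     (simp_all only: act_add_left act_add_right act_scale_left act_scale_right
       act_sesquilinear_left act_sesquilinear_right)

section \<open>Cartan's formula as a recursion for the differential\<close>

context mpol_module
begin

text \<open>
  The dependence of a cochain on one of its arguments, when \<open>\<sigma>\<close> is substituted for the corresponding
  variable.
\<close>

definition sesquilinear_at ::
    "('a poly \<Rightarrow> 'b::ab_group_add \<Rightarrow> 'b) \<Rightarrow> 'a poly mpol \<Rightarrow> ('b \<Rightarrow> 'm mpol) \<Rightarrow> bool"
  where "sesquilinear_at sA \<sigma> \<psi> \<longleftrightarrow>
    additive \<psi> \<and> (\<forall>c a. \<psi> (sA [:c:] a) = pscale s (const [:c:]) (\<psi> a)) \<and>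
    (\<forall>a. \<psi> (sA [:0, 1:] a) = pscale s (- \<sigma>) (\<psi> a))"

lemma sesquilinear_at_add:
  "sesquilinear_at sA \<sigma> \<psi> \<Longrightarrow> sesquilinear_at sA \<sigma> \<psi>' \<Longrightarrow> sesquilinear_at sA \<sigma> (\<lambda>a. \<psi> a + \<psi>' a)"
  by (simp add: sesquilinear_at_def additive_plus P.scale_right_distrib del: P.scale_minus_left)

lemma sesquilinear_at_pscale:
  "sesquilinear_at sA \<sigma> \<psi> \<Longrightarrow> sesquilinear_at sA \<sigma> (\<lambda>a. pscale s r (\<psi> a))"
  by (simp add: sesquilinear_at_def additive_compose[OF additive_pscale] mult.commute)

lemma sesquilinear_at_minus:
  "sesquilinear_at sA \<sigma> \<psi> \<Longrightarrow> sesquilinear_at sA \<sigma> (\<lambda>a. - \<psi> a)"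
  using sesquilinear_at_pscale[of sA \<sigma> \<psi> "- 1"] by simp

lemma sesquilinear_at_diff:
  assumes "sesquilinear_at sA \<sigma> \<psi>" "sesquilinear_at sA \<sigma> \<psi>'"
  shows "sesquilinear_at sA \<sigma> (\<lambda>a. \<psi> a - \<psi>' a)"
  using sesquilinear_at_add[OF assms(1) sesquilinear_at_minus[OF assms(2)]] by simp

lemma sesquilinear_at_0: "sesquilinear_at sA \<sigma> (\<lambda>a. 0)"
  by (simp add: sesquilinear_at_def additive_def)

end

text \<open>
  The change of sign is required for adjacent arguments only. In this form it passes to functions that
  are defined by recursion on the list.
\<close>

definition alternating :: "('x list \<Rightarrow> 'v::ab_group_add) \<Rightarrow> bool"
  where "alternating \<Phi> \<longleftrightarrow> (\<forall>us x y vs. \<Phi> (us @ x # y # vs) = - \<Phi> (us @ y # x # vs))"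

lemma alternatingI:
  "(\<And>us x y vs. \<Phi> (us @ x # y # vs) = - \<Phi> (us @ y # x # vs)) \<Longrightarrow> alternating \<Phi>"
  unfolding alternating_def by blast

lemma alternatingD: "alternating \<Phi> \<Longrightarrow> \<Phi> (us @ x # y # vs) = - \<Phi> (us @ y # x # vs)"
  unfolding alternating_def by blast

lemma alternating_Cons:
  assumes "alternating \<Phi>"
  shows "alternating (\<lambda>xs. \<Phi> (x # xs))"
proof (rule alternatingI)
  fix us y z vs
  show "\<Phi> (x # us @ y # z # vs) = - \<Phi> (x # us @ z # y # vs)"
    using alternatingD[OF assms, of "x # us" y z vs] by simp
qed

lemma alternating_swap: "alternating \<Phi> \<Longrightarrow> \<Phi> (x # y # vs) = - \<Phi> (y # x # vs)"
  using alternatingD[of \<Phi> "[]" x y vs] by simp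

text \<open>
  An argument \<open>(\<sigma>, a)\<close> of a cochain consists of an element \<open>a\<close> of the algebra and of the polynomial \<open>\<sigma>\<close>
  substituted for its variable.
\<close>

type_synonym ('a, 'b) arg = "'a poly mpol \<times> 'b"

abbreviation arg_subst :: "(nat \<Rightarrow> 'a::field poly mpol) \<Rightarrow> ('a, 'b) arg \<Rightarrow> ('a, 'b) arg"
  where "arg_subst \<tau> \<equiv> apfst (rsubst \<tau>)"

context lca_module
begin

abbreviation act_at :: "('a, 'b) arg \<Rightarrow> 'm mpol \<Rightarrow> 'm mpol"
  where "act_at x v \<equiv> lam_at sM act (fst x) (const (snd x)) v"

text \<open>
  The extension of \<open>\<psi>\<close> to polynomials over the algebra, with \<open>\<sigma>\<close> substituted for the variables.
\<close>

definition lin_ext :: "(nat \<Rightarrow> 'a poly mpol) \<Rightarrow> ('b \<Rightarrow> 'm mpol) \<Rightarrow> 'b mpol \<Rightarrow> 'm mpol"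
  where "lin_ext \<sigma> \<psi> = lsum (\<lambda>\<alpha> c. pscale sM (mpow \<sigma> \<alpha>) (\<psi> c))"

text \<open>
  \<open>\<Psi>\<close> at the bracket of \<open>(\<sigma>, a)\<close> and \<open>(\<tau>, b)\<close>, which is the argument \<open>(\<sigma> + \<tau>, [a\<^sub>\<sigma> b])\<close>. As \<open>[a\<^sub>\<sigma> b]\<close> is a
  polynomial over the algebra, \<open>\<Psi>\<close> is extended linearly.
\<close>

definition at_bracket ::
    "(('a, 'b) arg \<Rightarrow> 'm mpol) \<Rightarrow> ('a, 'b) arg \<Rightarrow> ('a, 'b) arg \<Rightarrow> 'm mpol"
  where "at_bracket \<Psi> x y =
    lin_ext (\<lambda>_. fst x) (\<lambda>c. \<Psi> (fst x + fst y, c))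
      (lam_at sA br (var 0) (const (snd x)) (const (snd y)))"

lemma lin_ext_single:
  "additive \<psi> \<Longrightarrow> lin_ext \<sigma> \<psi> (Poly_Mapping.single \<alpha> c) = pscale sM (mpow \<sigma> \<alpha>) (\<psi> c)"
  unfolding lin_ext_def
  by (intro lsum_single additive_compose[OF act.additive_pscale])

lemma additive_lin_ext: "additive \<psi> \<Longrightarrow> additive (lin_ext \<sigma> \<psi>)"
  unfolding lin_ext_def
  by (intro additive_lsum additive_compose[OF act.additive_pscale])

lemma lin_ext_const: "additive \<psi> \<Longrightarrow> lin_ext \<sigma> \<psi> (const c) = \<psi> c"
  using lin_ext_single[of \<psi> \<sigma> 0 c] by (simp add: const_def)

lemma lin_ext_var:
  assumes "additive \<psi>"
  shows "lin_ext \<sigma> \<psi> (pscale sA (var i) u) = pscale sM (\<sigma> i) (lin_ext \<sigma> \<psi> u)"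
proof (induction u rule: mpol_induct)
  case (single \<beta> w)
  have "pscale sA (var i) (Poly_Mapping.single \<beta> w)
      = Poly_Mapping.single (Poly_Mapping.single i 1 + \<beta>) w"
    using br.pscale_single[of "Poly_Mapping.single i 1" 1 \<beta> w] by (simp add: var_def lmonom_def)
  then show ?case by (simp add: lin_ext_single assms mpow_add)
qed (simp add: br.P.scale_right_distrib act.P.scale_right_distrib
      additive.add[OF additive_lin_ext] assms)

text \<open>
  For a sesquilinear \<open>\<psi>\<close> at \<open>\<rho>\<close>, the operator \<open>\<partial>\<close> on the argument becomes multiplication by \<open>-\<rho>\<close>.
\<close>

lemma lin_ext_scalar:
  assumes "act.sesquilinear_at sA \<rho> \<psi>"
  shows "lin_ext \<sigma> \<psi> (pscale sA (const [:c:]) u) = pscale sM (const [:c:]) (lin_ext \<sigma> \<psi> u)"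
    (is ?scalar)
    and "lin_ext \<sigma> \<psi> (pscale sA del u) = pscale sM (- \<rho>) (lin_ext \<sigma> \<psi> u)" (is ?del)
proof -
  have \<psi>: "additive \<psi>" "\<And>c a. \<psi> (sA [:c:] a) = pscale sM (const [:c:]) (\<psi> a)"
    "\<And>a. \<psi> (sA [:0, 1:] a) = pscale sM (- \<rho>) (\<psi> a)"
    using assms by (simp_all add: act.sesquilinear_at_def)
  have single: "pscale sA (const p) (Poly_Mapping.single \<beta> w) = Poly_Mapping.single \<beta> (sA p w)"
    for p \<beta> w
    using br.pscale_single[of 0 p \<beta> w] by (simp add: const_def)
  show ?scalar
    by (induction u rule: mpol_induct)
       (simp_all add: single lin_ext_single \<psi> mult.commute br.P.scale_right_distrib
         act.P.scale_right_distrib additive.add[OF additive_lin_ext])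
  show ?del
    by (induction u rule: mpol_induct)
       (simp_all add: del_def single lin_ext_single \<psi> mult.commute br.P.scale_right_distrib
         act.P.scale_right_distrib additive.add[OF additive_lin_ext] del: act.P.scale_minus_left)
qed

lemma lin_ext_peval:
  assumes "additive \<psi>"
    and "\<And>u. lin_ext \<sigma> \<psi> (pscale sA \<theta> u) = pscale sM r (lin_ext \<sigma> \<psi> u)"
  shows "lin_ext \<sigma> \<psi> (br.peval \<theta> P) = (\<Sum>n\<le>degree P. pscale sM (r ^ n) (\<psi> (coeff P n)))"
proof -
  have "lin_ext \<sigma> \<psi> (pscale sA (\<theta> ^ n) u) = pscale sM (r ^ n) (lin_ext \<sigma> \<psi> u)" for n u
  proof (induction n)
    case (Suc n)
    have "lin_ext \<sigma> \<psi> (pscale sA (\<theta> ^ Suc n) u)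
        = lin_ext \<sigma> \<psi> (pscale sA \<theta> (pscale sA (\<theta> ^ n) u))" by simp
    also have "\<dots> = pscale sM (r ^ Suc n) (lin_ext \<sigma> \<psi> u)"
      unfolding assms(2) Suc.IH by simp
    finally show ?case .
  qed simp
  then show ?thesis
    by (simp add: br.peval_def additive.sum[OF additive_lin_ext] assms(1) lin_ext_const)
qed

lemma at_bracket_eq:
  assumes "additive (\<lambda>c. \<Psi> (fst x + fst y, c))"
  shows "at_bracket \<Psi> x y
    = (\<Sum>n\<le>degree (br (snd x) (snd y)).
        pscale sM (fst x ^ n) (\<Psi> (fst x + fst y, coeff (br (snd x) (snd y)) n)))"
  unfolding at_bracket_def br.lam_at_const
  by (rule lin_ext_peval) (simp_all add: assms lin_ext_var)

text \<open>
  In \<open>[a\<^sub>\<lambda> b] = -[b\<^bsub>-\<lambda>-\<partial>\<^esub> a]\<close> a sesquilinear function at \<open>\<sigma> + \<tau>\<close> turns \<open>\<partial>\<close> into \<open>-(\<sigma> + \<tau>)\<close>, and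
  \<open>-\<sigma> + (\<sigma> + \<tau>) = \<tau>\<close>.
\<close>

lemma at_bracket_skew:
  assumes "act.sesquilinear_at sA (fst x + fst y) (\<lambda>c. \<Psi> (fst x + fst y, c))"
  shows "at_bracket \<Psi> x y = - at_bracket \<Psi> y x"
proof -
  let ?\<psi> = "\<lambda>c. \<Psi> (fst x + fst y, c)"
  have \<psi>: "additive ?\<psi>" using assms by (simp add: act.sesquilinear_at_def)
  let ?E = "lin_ext (\<lambda>_. fst x) ?\<psi>" and ?P = "br (snd y) (snd x)"
  have E: "?E (pscale sA (- var 0 - del) u) = pscale sM (fst y) (?E u)" for u
  proof -
    have "?E (pscale sA (- var 0 - del) u)
        = - ?E (pscale sA (var 0) u) - ?E (pscale sA del u)"
      by (simp add: br.P.scale_left_diff_distrib additive.diff[OF additive_lin_ext]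
          additive.minus[OF additive_lin_ext] \<psi>)
    also have "\<dots> = pscale sM (- fst x + (fst x + fst y)) (?E u)"
      unfolding lin_ext_var[OF \<psi>] lin_ext_scalar(2)[OF assms]
      by (simp add: act.P.scale_left_distrib act.P.scale_left_diff_distrib)
    finally show ?thesis by simp
  qed
  have "br.peval (var 0) (br (snd x) (snd y)) = - br.peval (- var 0 - del) ?P"
    using br_skew[of "snd x" "snd y"] unfolding br.lam_at_const .
  then have "at_bracket \<Psi> x y = - ?E (br.peval (- var 0 - del) ?P)"
    unfolding at_bracket_def br.lam_at_const
    by (simp only: additive.minus[OF additive_lin_ext[OF \<psi>]])
  also have "?E (br.peval (- var 0 - del) ?P) = at_bracket \<Psi> y x"
    using \<psi> by (simp add: lin_ext_peval[OF \<psi> E] at_bracket_eq add.commute)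
  finally show ?thesis .
qed

lemma at_bracket_sesquilinear:
  assumes "act.sesquilinear_at sA (\<sigma> + fst y) (\<lambda>c. \<Psi> (\<sigma> + fst y, c))"
  shows "act.sesquilinear_at sA \<sigma> (\<lambda>a. at_bracket \<Psi> (\<sigma>, a) y)"
proof -
  have \<psi>: "additive (\<lambda>c. \<Psi> (\<sigma> + fst y, c))" using assms by (simp add: act.sesquilinear_at_def)
  show ?thesis
    unfolding act.sesquilinear_at_def at_bracket_def additive_def
    by (simp add: br.lam_at_add_left br.lam_at_scale_left br.lam_at_del_left
        additive.add[OF additive_lin_ext[OF \<psi>]] additive.minus[OF additive_lin_ext[OF \<psi>]]
        lin_ext_scalar(1)[OF assms] lin_ext_var[OF \<psi>])
qed

lemma at_bracket_pscale:
  "at_bracket (\<lambda>z. pscale sM (g (fst z)) (\<Psi> z)) x y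
    = pscale sM (g (fst x + fst y)) (at_bracket \<Psi> x y)"
  by (simp add: at_bracket_def lin_ext_def lsum_def act.P.scale_sum_right mult.commute)

lemma at_bracket_minus: "at_bracket (\<lambda>z. - \<Psi> z) x y = - at_bracket \<Psi> x y"
  using at_bracket_pscale[of "\<lambda>_. - 1"] by simp

lemma at_bracket_add: "at_bracket (\<lambda>z. \<Psi> z + \<Psi>' z) x y = at_bracket \<Psi> x y + at_bracket \<Psi>' x y"
  by (simp add: at_bracket_def lin_ext_def lsum_def act.P.scale_right_distrib sum.distrib)

lemma psubst_at_bracket:
  assumes "\<And>z. psubst sM \<tau> (\<Psi> z) = \<Psi>' (arg_subst \<tau> z)"
  shows "psubst sM \<tau> (at_bracket \<Psi> x y) = at_bracket \<Psi>' (arg_subst \<tau> x) (arg_subst \<tau> y)"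
  by (simp add: at_bracket_def lin_ext_def lsum_def act.psubst_sum act.psubst_pscale
      rsubst_mpow assms R.psubst_add)

text \<open>
  The sum over all positions \<open>i\<close> of \<open>\<Phi>\<close> with the \<open>i\<close>-th argument \<open>y\<close> replaced by the bracket of \<open>x\<close>
  and \<open>y\<close>.
\<close>

primrec bracket_args :: "('a, 'b) arg \<Rightarrow> (('a, 'b) arg list \<Rightarrow> 'm mpol) \<Rightarrow> ('a, 'b) arg list \<Rightarrow> 'm mpol"
  where
    "bracket_args x \<Phi> [] = 0"
  | "bracket_args x \<Phi> (y # ys) = at_bracket (\<lambda>z. \<Phi> (z # ys)) x y + bracket_args x (\<lambda>zs. \<Phi> (y # zs)) ys"

definition lie_derivative :: "('a, 'b) arg \<Rightarrow> (('a, 'b) arg list \<Rightarrow> 'm mpol) \<Rightarrow> ('a, 'b) arg list \<Rightarrow> 'm mpol"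
  where "lie_derivative x \<Phi> xs = act_at x (\<Phi> xs) - bracket_args x \<Phi> xs"

text \<open>
  Cartan's formula, solved for the contraction of \<open>d \<Phi>\<close> by \<open>x\<close>. The value on the empty list is 0, since a
  differential has at least one argument.
\<close>

primrec cartan_d :: "(('a, 'b) arg list \<Rightarrow> 'm mpol) \<Rightarrow> ('a, 'b) arg list \<Rightarrow> 'm mpol"
  where
    "cartan_d \<Phi> [] = 0"
  | "cartan_d \<Phi> (x # xs) = lie_derivative x \<Phi> xs - cartan_d (\<lambda>ys. \<Phi> (x # ys)) xs"

lemma bracket_args_add: "bracket_args x (\<lambda>ys. \<Phi> ys + \<Phi>' ys) xs = bracket_args x \<Phi> xs + bracket_args x \<Phi>' xs"
  by (induction xs arbitrary: \<Phi> \<Phi>') (simp_all add: at_bracket_add)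

lemma bracket_args_pscale: "bracket_args x (\<lambda>ys. pscale sM r (\<Phi> ys)) xs = pscale sM r (bracket_args x \<Phi> xs)"
  by (induction xs arbitrary: \<Phi>)
     (simp_all add: at_bracket_pscale[of "\<lambda>_. r"] act.P.scale_right_distrib)

lemma lie_derivative_add: "lie_derivative x (\<lambda>ys. \<Phi> ys + \<Phi>' ys) xs = lie_derivative x \<Phi> xs + lie_derivative x \<Phi>' xs"
  by (simp add: lie_derivative_def bracket_args_add act.lam_at_add)

lemma lie_derivative_pscale:
  "del_free r \<Longrightarrow> lie_derivative x (\<lambda>ys. pscale sM r (\<Phi> ys)) xs = pscale sM r (lie_derivative x \<Phi> xs)"
  by (simp add: lie_derivative_def bracket_args_pscale act.lam_at_del_free act.P.scale_right_diff_distrib)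

lemma cartan_d_add: "cartan_d (\<lambda>ys. \<Phi> ys + \<Phi>' ys) xs = cartan_d \<Phi> xs + cartan_d \<Phi>' xs"
  by (induction xs arbitrary: \<Phi> \<Phi>') (simp_all add: lie_derivative_add)

lemma cartan_d_pscale:
  "del_free r \<Longrightarrow> cartan_d (\<lambda>ys. pscale sM r (\<Phi> ys)) xs = pscale sM r (cartan_d \<Phi> xs)"
  by (induction xs arbitrary: \<Phi>) (simp_all add: lie_derivative_pscale act.P.scale_right_diff_distrib)

lemma bracket_args_minus: "bracket_args x (\<lambda>ys. - \<Phi> ys) xs = - bracket_args x \<Phi> xs"
  using bracket_args_pscale[of x "- 1"] by simp

lemma lie_derivative_minus: "lie_derivative x (\<lambda>ys. - \<Phi> ys) xs = - lie_derivative x \<Phi> xs"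
  by (simp add: lie_derivative_def bracket_args_minus additive.minus[OF act.additive_lam_at])

lemma cartan_d_minus: "cartan_d (\<lambda>ys. - \<Phi> ys) xs = - cartan_d \<Phi> xs"
  by (induction xs arbitrary: \<Phi>) (simp_all add: lie_derivative_minus)

text \<open>
  By skew-symmetry it suffices to consider the first argument (\<open>sesquilinear_Cons\<close>).
\<close>

definition sesquilinear :: "(('a, 'b) arg list \<Rightarrow> 'm mpol) \<Rightarrow> bool"
  where "sesquilinear \<Phi> \<longleftrightarrow>
    alternating \<Phi> \<and> (\<forall>\<sigma> xs. act.sesquilinear_at sA \<sigma> (\<lambda>a. \<Phi> ((\<sigma>, a) # xs)))"

lemma sesquilinear_Cons:
  assumes "sesquilinear \<Phi>"
  shows "sesquilinear (\<lambda>xs. \<Phi> (x # xs))"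
proof -
  have alt: "alternating \<Phi>" using assms by (simp add: sesquilinear_def)
  have "act.sesquilinear_at sA \<sigma> (\<lambda>a. \<Phi> (x # (\<sigma>, a) # xs))" for \<sigma> xs
    unfolding alternating_swap[OF alt, of x]
    using assms by (intro act.sesquilinear_at_minus) (simp add: sesquilinear_def)
  then show ?thesis by (simp add: sesquilinear_def alternating_Cons alt)
qed

lemma alternating_bracket_args:
  assumes "alternating \<Phi>"
  shows "alternating (bracket_args x \<Phi>)"
proof (rule alternatingI)
  fix us y z vs
  show "bracket_args x \<Phi> (us @ y # z # vs) = - bracket_args x \<Phi> (us @ z # y # vs)"
    using assms
  proof (induction us arbitrary: \<Phi>)
    case Nil
    have "(\<lambda>w. \<Phi> (w # z # vs)) = (\<lambda>w. - \<Phi> (z # w # vs))"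
      "(\<lambda>w. \<Phi> (y # w # vs)) = (\<lambda>w. - \<Phi> (w # y # vs))"
      "(\<lambda>ws. \<Phi> (y # z # ws)) = (\<lambda>ws. - \<Phi> (z # y # ws))"
      by (rule ext, rule alternating_swap[OF Nil])+
    then show ?case by (simp add: at_bracket_minus bracket_args_minus)
  next
    case (Cons u us)
    have "(\<lambda>w. \<Phi> (w # us @ y # z # vs)) = (\<lambda>w. - \<Phi> (w # us @ z # y # vs))"
      using alternatingD[OF Cons.prems, of "w # us" y z vs for w] by (intro ext) simp
    then show ?case
      using Cons.IH[OF alternating_Cons[OF Cons.prems]] by (simp add: at_bracket_minus)
  qed
qed

lemma alternating_lie_derivative:
  assumes "alternating \<Phi>"
  shows "alternating (lie_derivative x \<Phi>)"
proof (rule alternatingI)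
  fix us y z vs
  show "lie_derivative x \<Phi> (us @ y # z # vs) = - lie_derivative x \<Phi> (us @ z # y # vs)"
    unfolding lie_derivative_def alternatingD[OF assms, of us y z vs]
      alternatingD[OF alternating_bracket_args[OF assms], of x us y z vs]
      additive.minus[OF act.additive_lam_at] by simp
qed

text \<open>
  For the first two arguments \<open>y\<close>, \<open>z\<close>, applying the recursion twice gives
  \<open>\<theta>\<^sub>y (\<Phi> (z # \<cdot>)) - \<theta>\<^sub>z (\<Phi> (y # \<cdot>)) - \<Phi> ([y, z] # \<cdot>) + d (\<Phi> (y # z # \<cdot>))\<close>, and the
  difference of the first two terms is skew in \<open>y\<close> and \<open>z\<close>, as is each of the others.
\<close>

lemma alternating_cartan_d:
  assumes "sesquilinear \<Phi>"
  shows "alternating (cartan_d \<Phi>)"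
proof (rule alternatingI)
  fix us y z vs
  show "cartan_d \<Phi> (us @ y # z # vs) = - cartan_d \<Phi> (us @ z # y # vs)"
    using assms
  proof (induction us arbitrary: \<Phi>)
    case Nil
    then have alt: "alternating \<Phi>" by (simp add: sesquilinear_def)
    have "(\<lambda>ws. \<Phi> (y # z # ws)) = (\<lambda>ws. - \<Phi> (z # y # ws))"
      by (rule ext, rule alternating_swap[OF alt])
    moreover have "at_bracket (\<lambda>w. \<Phi> (w # vs)) y z = - at_bracket (\<lambda>w. \<Phi> (w # vs)) z y"
      using Nil by (intro at_bracket_skew) (simp add: sesquilinear_def)
    ultimately show ?case by (simp add: lie_derivative_def cartan_d_minus)
  next
    case (Cons u us)
    have "alternating (lie_derivative u \<Phi>)"
      using Cons.prems by (intro alternating_lie_derivative) (simp add: sesquilinear_def)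
    from alternatingD[OF this, of us y z vs] show ?case
      using Cons.IH[OF sesquilinear_Cons[OF Cons.prems]] by simp
  qed
qed

lemma sesquilinear_at_bracket_args:
  "sesquilinear \<Phi> \<Longrightarrow> act.sesquilinear_at sA \<sigma> (\<lambda>a. bracket_args (\<sigma>, a) \<Phi> xs)"
proof (induction xs arbitrary: \<Phi>)
  case Nil
  show ?case by (simp add: act.sesquilinear_at_0)
next
  case (Cons y ys)
  have "act.sesquilinear_at sA \<sigma> (\<lambda>a. at_bracket (\<lambda>z. \<Phi> (z # ys)) (\<sigma>, a) y)"
    using Cons.prems by (intro at_bracket_sesquilinear) (simp add: sesquilinear_def)
  then show ?case
    using Cons.IH[OF sesquilinear_Cons[OF Cons.prems]] by (simp add: act.sesquilinear_at_add)
qed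

lemma sesquilinear_at_act: "act.sesquilinear_at sA \<sigma> (\<lambda>a. act_at (\<sigma>, a) v)"
  unfolding act.sesquilinear_at_def additive_def
  by (simp add: act.lam_at_add_left act.lam_at_scale_left act.lam_at_del_left)

text \<open>
  The factor \<open>-\<sigma>\<close> has to pass through the actions of the other arguments, and this is where \<open>\<sigma>\<close> must not
  contain \<open>\<partial>\<close>.
\<close>

lemma sesquilinear_at_cartan_d:
  assumes "sesquilinear \<Phi>" "del_free \<sigma>"
  shows "act.sesquilinear_at sA \<sigma> (\<lambda>a. cartan_d \<Phi> ((\<sigma>, a) # xs))"
proof -
  have \<Phi>: "act.sesquilinear_at sA \<sigma> (\<lambda>a. \<Phi> ((\<sigma>, a) # ys))" for ys
    using assms by (simp add: sesquilinear_def)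
  have "act.sesquilinear_at sA \<sigma> (\<lambda>a. cartan_d (\<lambda>ys. \<Phi> ((\<sigma>, a) # ys)) xs)"
    using \<Phi> unfolding act.sesquilinear_at_def additive_def
    by (simp add: cartan_d_add cartan_d_pscale del_free.const del_free_minus assms(2)
        del: act.P.scale_minus_left)
  then show ?thesis
    unfolding cartan_d.simps lie_derivative_def
    by (intro act.sesquilinear_at_diff sesquilinear_at_bracket_args sesquilinear_at_act assms(1))
qed

lemma psubst_bracket_args:
  assumes "\<And>xs. psubst sM \<tau> (\<Phi> xs) = \<Phi>' (map (arg_subst \<tau>) xs)"
  shows "psubst sM \<tau> (bracket_args x \<Phi> xs) = bracket_args (arg_subst \<tau> x) \<Phi>' (map (arg_subst \<tau>) xs)"
  using assms
proof (induction xs arbitrary: \<Phi> \<Phi>')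
  case (Cons y ys)
  have "psubst sM \<tau> (at_bracket (\<lambda>z. \<Phi> (z # ys)) x y)
      = at_bracket (\<lambda>z. \<Phi>' (z # map (arg_subst \<tau>) ys)) (arg_subst \<tau> x) (arg_subst \<tau> y)"
    by (rule psubst_at_bracket) (simp add: Cons.prems)
  moreover have "psubst sM \<tau> (bracket_args x (\<lambda>zs. \<Phi> (y # zs)) ys)
      = bracket_args (arg_subst \<tau> x) (\<lambda>zs. \<Phi>' (arg_subst \<tau> y # zs)) (map (arg_subst \<tau>) ys)"
    by (rule Cons.IH) (simp add: Cons.prems)
  ultimately show ?case by (simp add: act.psubst_add)
qed simp

text \<open>
  The function \<open>\<Phi>'\<close> is allowed to differ from \<open>\<Phi>\<close> because the recursion fixes a first argument, on
  which the substitution acts as well.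
\<close>

lemma psubst_cartan_d:
  assumes "\<And>i. del_free (\<tau> i)"
    and "\<And>xs. psubst sM \<tau> (\<Phi> xs) = \<Phi>' (map (arg_subst \<tau>) xs)"
  shows "psubst sM \<tau> (cartan_d \<Phi> xs) = cartan_d \<Phi>' (map (arg_subst \<tau>) xs)"
  using assms(2)
proof (induction xs arbitrary: \<Phi> \<Phi>')
  case (Cons x xs)
  have "psubst sM \<tau> (cartan_d (\<lambda>ys. \<Phi> (x # ys)) xs)
      = cartan_d (\<lambda>ys. \<Phi>' (arg_subst \<tau> x # ys)) (map (arg_subst \<tau>) xs)"
    by (rule Cons.IH) (simp add: Cons.prems)
  then show ?case
    by (simp add: act.psubst_diff lie_derivative_def psubst_bracket_args[of \<tau> \<Phi> \<Phi>'] act.psubst_lam_at assms(1) Cons.prems)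
qed simp

abbreviation weight :: "('a, 'b) arg list \<Rightarrow> 'a poly mpol"
  where "weight xs \<equiv> sum_list (map fst xs)"

text \<open>
  The summand \<open>\<rho>\<close> collects the weights of the arguments that the recursion has already fixed. A bracket
  with \<open>x\<close> adds \<open>fst x\<close> to the weight of the list.
\<close>

lemma bracket_args_del:
  "bracket_args x (\<lambda>ys. pscale sM (del + \<rho> + weight ys) (\<Phi> ys)) xs
    = pscale sM (del + \<rho> + (fst x + weight xs)) (bracket_args x \<Phi> xs)"
proof (induction xs arbitrary: \<Phi> \<rho>)
  case (Cons y ys)
  have "at_bracket (\<lambda>z. pscale sM (del + \<rho> + weight (z # ys)) (\<Phi> (z # ys))) x y
      = pscale sM (del + \<rho> + (fst x + fst y + weight ys)) (at_bracket (\<lambda>z. \<Phi> (z # ys)) x y)"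
    using at_bracket_pscale[of "\<lambda>\<sigma>. del + \<rho> + (\<sigma> + weight ys)"] by simp
  moreover have "bracket_args x (\<lambda>zs. pscale sM (del + \<rho> + weight (y # zs)) (\<Phi> (y # zs))) ys
      = pscale sM (del + (\<rho> + fst y) + (fst x + weight ys)) (bracket_args x (\<lambda>zs. \<Phi> (y # zs)) ys)"
    using Cons.IH[of "\<rho> + fst y"] by (simp add: add_ac)
  ultimately show ?case
    by (simp only: bracket_args.simps act.P.scale_right_distrib) (simp add: add_ac)
qed simp

text \<open>
  The action of \<open>x\<close> replaces \<open>\<partial>\<close> by \<open>\<partial> + fst x\<close>, which is the weight that \<open>x\<close> contributes to the longer
  list.
\<close>

lemma cartan_d_del:
  assumes "del_free \<rho>" "\<forall>x\<in>set xs. del_free (fst x)"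
  shows "cartan_d (\<lambda>ys. pscale sM (del + \<rho> + weight ys) (\<Phi> ys)) xs
    = pscale sM (del + \<rho> + weight xs) (cartan_d \<Phi> xs)"
  using assms
proof (induction xs arbitrary: \<Phi> \<rho>)
  case (Cons x xs)
  have free: "del_free (weight xs)"
    using Cons.prems(2) by (induction xs) (simp_all add: del_free.add)
  have "act_at x (pscale sM (del + \<rho> + weight xs) (\<Phi> xs))
      = pscale sM (del + \<rho> + weight (x # xs)) (act_at x (\<Phi> xs))"
    by (simp add: act.P.scale_left_distrib act.lam_at_add act.lam_at_del_free act.lam_at_del_right
        free Cons.prems)
  then have "lie_derivative x (\<lambda>ys. pscale sM (del + \<rho> + weight ys) (\<Phi> ys)) xs
      = pscale sM (del + \<rho> + weight (x # xs)) (lie_derivative x \<Phi> xs)"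
    unfolding lie_derivative_def bracket_args_del by (simp add: act.P.scale_right_diff_distrib)
  moreover have "cartan_d (\<lambda>ys. pscale sM (del + \<rho> + weight (x # ys)) (\<Phi> (x # ys))) xs
      = pscale sM (del + \<rho> + weight (x # xs)) (cartan_d (\<lambda>ys. \<Phi> (x # ys)) xs)"
    using Cons.IH[of "\<rho> + fst x" "\<lambda>ys. \<Phi> (x # ys)"] Cons.prems by (simp add: add_ac del_free.add)
  ultimately show ?case
    by (simp only: cartan_d.simps act.P.scale_right_diff_distrib)
qed simp

end

section \<open>Cochains as functions of lists of arguments\<close>

lemma alternating_move:
  assumes "alternating (\<Phi> :: 'x list \<Rightarrow> 'v::ab_group_add)"
  shows "\<Phi> (us @ x # vs @ ws) = (if even (length vs) then id else uminus) (\<Phi> (us @ vs @ x # ws))"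
proof (induction vs arbitrary: us)
  case (Cons v vs)
  have "\<Phi> (us @ x # (v # vs) @ ws) = - \<Phi> ((us @ [v]) @ x # vs @ ws)"
    using alternatingD[OF assms, of us x v "vs @ ws"] by simp
  then show ?case unfolding Cons.IH[of "us @ [v]"] by simp
qed simp

lemma alternating_exchange:
  assumes "alternating (\<Phi> :: 'x list \<Rightarrow> 'v::ab_group_add)"
  shows "\<Phi> (us @ y # vs @ x # ws) = - \<Phi> (us @ x # vs @ y # ws)"
proof -
  have "\<Phi> (us @ vs @ y # x # ws) = - \<Phi> (us @ vs @ x # y # ws)"
    using alternatingD[OF assms, of "us @ vs" y x ws] by simp
  then show ?thesis
    using alternating_move[OF assms, of us y vs "x # ws"]
      alternating_move[OF assms, of us x vs "y # ws"] by (simp split: if_splits)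
qed

lemma permute_list_transpose:
  assumes "i < j" "j < length xs"
  obtains us x vs y ws where "xs = us @ x # vs @ y # ws"
    and "permute_list (Transposition.transpose i j) xs = us @ y # vs @ x # ws"
proof
  let ?us = "take i xs" and ?vs = "take (j - Suc i) (drop (Suc i) xs)" and ?ws = "drop (Suc j) xs"
  have "drop i xs = xs ! i # drop (Suc i) xs" "drop j xs = xs ! j # drop (Suc j) xs"
    using assms by (simp_all add: Cons_nth_drop_Suc)
  moreover have "drop (Suc i) xs = ?vs @ drop j xs"
    using append_take_drop_id[of "j - Suc i" "drop (Suc i) xs"] assms by simp
  ultimately show xs: "xs = ?us @ xs ! i # ?vs @ xs ! j # ?ws"
    using append_take_drop_id[of i xs] by simp
  show "permute_list (Transposition.transpose i j) xs = ?us @ xs ! j # ?vs @ xs ! i # ?ws"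
    using assms
    by (intro nth_equalityI)
       (auto simp: permute_list_def Transposition.transpose_def nth_append nth_Cons'
         min_def intro!: arg_cong[where f = "(!) xs"])
qed

context lca_module
begin

text \<open>
  Compatibility with all substitutions whose values satisfy \<open>P\<close>. Functions that come
  from cochains are natural for arbitrary substitutions, whereas \<open>cartan_d\<close> preserves naturality only for
  substitutions without \<open>\<partial>\<close>.
\<close>

definition natural :: "('a poly mpol \<Rightarrow> bool) \<Rightarrow> (('a, 'b) arg list \<Rightarrow> 'm mpol) \<Rightarrow> bool"
  where "natural P \<Phi> \<longleftrightarrow>
    (\<forall>\<tau> xs. (\<forall>i. P (\<tau> i)) \<longrightarrow> psubst sM \<tau> (\<Phi> xs) = \<Phi> (map (arg_subst \<tau>) xs))"

lemma naturalD:
  "natural P \<Phi> \<Longrightarrow> (\<And>i. P (\<tau> i)) \<Longrightarrow> psubst sM \<tau> (\<Phi> xs) = \<Phi> (map (arg_subst \<tau>) xs)"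
  by (simp add: natural_def)

definition eval_cochain :: "('b list \<Rightarrow> 'm mpol) \<Rightarrow> ('a, 'b) arg list \<Rightarrow> 'm mpol"
  where "eval_cochain f xs = cochain_at sM f (map fst xs) (map snd xs)"

text \<open>
  The inverse of \<open>eval_cochain\<close>: a natural function of \<open>q\<close> arguments is determined by its values at
  the formal variables (\<open>restrict_eval\<close>, \<open>eval_restrict\<close>).
\<close>

definition restrict_to_vars :: "nat \<Rightarrow> (('a, 'b) arg list \<Rightarrow> 'm mpol) \<Rightarrow> 'b list \<Rightarrow> 'm mpol"
  where "restrict_to_vars q \<Phi> = (\<lambda>as. if length as = q then \<Phi> (zip (vars q) as) else 0)"

lemma vars_simps [simp]: "length (vars q) = q" "i < q \<Longrightarrow> vars q ! i = var i"
  by (simp_all add: vars_def)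

text \<open>
  By naturality, the value at \<open>\<lambda>\<^sub>0, \<dots>, \<lambda>\<^bsub>q-1\<^esub>\<close> is unchanged if the other variables are replaced by 0.
\<close>

lemma supp_natural:
  assumes "natural P \<Phi>" "P 0" "\<And>i. P (var i)" "length as = q"
    and "\<alpha> \<in> supp (\<Phi> (zip (vars q) as))"
  shows "supp \<alpha> \<subseteq> {..<q}"
proof (rule act.supp_subset_if_psubst_eq)
  let ?\<tau> = "\<lambda>i. if i \<in> {..<q} then var i else 0 :: 'a poly mpol"
  have "map (arg_subst ?\<tau>) (zip (vars q) as) = zip (vars q) as"
    using assms(4) by (intro nth_equalityI) (simp_all add: apfst_def map_prod_def)
  then show "psubst sM ?\<tau> (\<Phi> (zip (vars q) as)) = \<Phi> (zip (vars q) as)"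
    using naturalD[OF assms(1), of ?\<tau> "zip (vars q) as"] assms(2,3) by simp
qed fact

lemma eval_restrict:
  assumes "natural P \<Phi>" "P 0" "\<And>i. P (var i)"
    and "length xs = q" "\<And>x. x \<in> set xs \<Longrightarrow> P (fst x)"
  shows "eval_cochain (restrict_to_vars q \<Phi>) xs = \<Phi> xs"
proof -
  let ?\<tau> = "\<lambda>i. if i < q then fst (xs ! i) else 0"
  let ?ys = "zip (vars q) (map snd xs)"
  have "eval_cochain (restrict_to_vars q \<Phi>) xs = psubst sM ((!) (map fst xs)) (\<Phi> ?ys)"
    using assms(4) by (simp add: eval_cochain_def cochain_at_def restrict_to_vars_def)
  also have "\<dots> = psubst sM ?\<tau> (\<Phi> ?ys)"
    by (rule act.psubst_cong[OF supp_natural[OF assms(1-3)]]) (use assms(4) in auto)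
  also have "\<dots> = \<Phi> (map (arg_subst ?\<tau>) ?ys)"
    using assms by (intro naturalD[OF assms(1)]) simp
  also have "map (arg_subst ?\<tau>) ?ys = xs"
    using assms(4) by (intro nth_equalityI) (simp_all add: apfst_def map_prod_def)
  finally show ?thesis .
qed

text \<open>
  Permutations are products of transpositions, and these are products of exchanges of adjacent entries.
\<close>

lemma alternating_permute:
  assumes "alternating \<Phi>" "\<pi> permutes {..<length xs}"
  shows "\<Phi> (permute_list \<pi> xs) = pscale sM (of_int (sign \<pi>)) (\<Phi> xs)"
  using finite_lessThan assms(2)
proof (induction rule: permutes_rev_induct)
  case id
  show ?case by simp
next
  case (swap i j \<pi>)
  have exchange: "\<Phi> (permute_list (Transposition.transpose i j) ys) = - \<Phi> ys"
    if ij: "i < j" "j < length ys" for i j ys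
    by (rule permute_list_transpose[OF ij]) (metis alternating_exchange[OF assms(1)])
  have "\<Phi> (permute_list (Transposition.transpose i j) (permute_list \<pi> xs))
      = - \<Phi> (permute_list \<pi> xs)"
    using exchange[of i j "permute_list \<pi> xs"] exchange[of j i "permute_list \<pi> xs"] swap(1-3)
    by (cases i j rule: linorder_cases) (simp_all add: transpose_commute)
  moreover have "Transposition.transpose i j permutes {..<length xs}"
    using swap(1,2) by (simp add: permutes_swap_id)
  moreover have "sign (\<pi> \<circ> Transposition.transpose i j) = - sign \<pi>"
    using swap(3,4) permutes_imp_permutation[OF finite_lessThan swap(4)]
    by (simp add: sign_compose permutation_swap_id sign_swap_id)
  ultimately show ?case
    by (simp only: permute_list_compose swap(5) of_int_minus act.P.scale_minus_left)
qed

lemma map_arg_subst_zip: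
  assumes "length as = q" "\<And>i. i < q \<Longrightarrow> \<tau> i = \<sigma>s ! i" "length \<sigma>s = q"
  shows "map (arg_subst \<tau>) (zip (vars q) as) = zip \<sigma>s as"
  using assms by (intro nth_equalityI) (simp_all add: apfst_def map_prod_def)

text \<open>
  Naturality translates a permutation of the variables into a permutation of the list of arguments, and
  skew-symmetry reduces the conditions on the \<open>i\<close>-th argument to the first one.
\<close>

lemma restrict_cochain:
  assumes nat: "natural del_free \<Phi>" and alt: "alternating \<Phi>"
    and sesq: "\<And>\<sigma> xs. del_free \<sigma> \<Longrightarrow> act.sesquilinear_at sA \<sigma> (\<lambda>a. \<Phi> ((\<sigma>, a) # xs))"
  shows "restrict_to_vars q \<Phi> \<in> basic_cochains sA sM q"
proof -
  let ?f = "restrict_to_vars q \<Phi>"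
  have f: "?f as = \<Phi> (zip (vars q) as)" if "length as = q" for as
    using that by (simp add: restrict_to_vars_def)
  note supp = supp_natural[OF nat del_free_0 del_free.var]
  have perm: "cochain_at sM ?f (permute_list \<pi> (vars q)) (permute_list \<pi> as)
      = pscale sM (of_int (sign \<pi>)) (?f as)"
    if as: "length as = q" and \<pi>: "\<pi> permutes {..<q}" for as \<pi>
  proof -
    let ?\<sigma>s = "permute_list \<pi> (vars q :: 'a poly mpol list)"
    let ?\<tau> = "\<lambda>i. if i < q then ?\<sigma>s ! i else 0"
    have \<pi>': "\<pi> permutes {..<length (vars q :: 'a poly mpol list)}" using \<pi> by simp
    have free: "del_free (?\<tau> i)" for i
      using permutes_in_image[OF \<pi>, of i]
      by (auto simp: permute_list_nth[OF \<pi>'] del_free.var)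
    have "cochain_at sM ?f ?\<sigma>s (permute_list \<pi> as)
        = psubst sM ((!) ?\<sigma>s) (\<Phi> (zip (vars q) (permute_list \<pi> as)))"
      using as by (simp add: cochain_at_def f)
    also have "\<dots> = psubst sM ?\<tau> (\<Phi> (zip (vars q) (permute_list \<pi> as)))"
      by (rule act.psubst_cong[OF supp]) (use as in auto)
    also have "\<dots> = \<Phi> (zip ?\<sigma>s (permute_list \<pi> as))"
      using as by (subst naturalD[OF nat free], subst map_arg_subst_zip) simp_all
    also have "\<dots> = \<Phi> (permute_list \<pi> (zip (vars q) as))"
      using as \<pi> by (subst permute_list_zip) simp_all
    also have "\<dots> = pscale sM (of_int (sign \<pi>)) (\<Phi> (zip (vars q) as))"
      using as \<pi> by (intro alternating_permute[OF alt]) simp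
    finally show ?thesis using as by (simp add: f)
  qed
  \<comment> \<open>The arguments other than the first are reached by moving them to the front.\<close>
  have at: "\<exists>zs. \<forall>x. ?f (as[i := x]) =
      (if even i then id else uminus) (\<Phi> ((var i, x) # zs))"
    if as: "length as = q" and i: "i < q" for as i
  proof (intro exI allI)
    let ?xs = "zip (vars q :: 'a poly mpol list) as"
    fix x
    have "(vars q :: 'a poly mpol list)[i := var i] = vars q"
      using i by (simp add: list_update_same_conv)
    then have "zip (vars q) (as[i := x]) = ?xs[i := (var i, x)]"
      using zip_update[of "vars q :: 'a poly mpol list" i "var i" as x] by simp
    also have "\<dots> = take i ?xs @ (var i, x) # drop (Suc i) ?xs"
      using as i by (simp add: upd_conv_take_nth_drop)
    finally have "?f (as[i := x]) = \<Phi> ([] @ take i ?xs @ (var i, x) # drop (Suc i) ?xs)"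
      using as by (simp add: f)
    also have "\<dots> = (if even i then id else uminus)
        (\<Phi> ((var i, x) # take i ?xs @ drop (Suc i) ?xs))"
      using alternating_move[OF alt, of "[]" "(var i, x)" "take i ?xs" "drop (Suc i) ?xs"] as i
      by (simp split: if_splits)
    finally show "?f (as[i := x])
      = (if even i then id else uminus) (\<Phi> ((var i, x) # take i ?xs @ drop (Suc i) ?xs))" .
  qed
  have slot: "act.sesquilinear_at sA (var i) (\<lambda>x. ?f (as[i := x]))"
    if as: "length as = q" and i: "i < q" for as i
  proof -
    obtain zs where zs: "\<And>x. ?f (as[i := x])
        = (if even i then id else uminus) (\<Phi> ((var i, x) # zs))"
      using at[OF as i] by blast
    show ?thesis
      unfolding zs using sesq[OF del_free.var, of i zs] by (simp add: act.sesquilinear_at_minus)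
  qed
  show ?thesis
    unfolding basic_cochains_def
  proof (intro CollectI conjI allI impI ballI)
    fix as :: "'b list" and \<alpha> assume "length as = q" "\<alpha> \<in> supp (?f as)"
    then show "supp \<alpha> \<subseteq> {..<q}" using supp[of as q \<alpha>] by (simp add: f)
  next
    fix as :: "'b list" and i x y assume "length as = q \<and> i < q"
    then show "?f (as[i := x + y]) = ?f (as[i := x]) + ?f (as[i := y])"
      using slot[of as i] by (simp add: act.sesquilinear_at_def additive_def)
  next
    fix as :: "'b list" and i c assume "length as = q \<and> i < q"
    then show "?f (as[i := sA [:c:] (as ! i)]) = pscale sM (const [:c:]) (?f as)"
      using slot[of as i] by (simp add: act.sesquilinear_at_def)
  next
    fix as :: "'b list" and i assume "length as = q \<and> i < q"
    then show "?f (as[i := sA [:0, 1:] (as ! i)]) = pscale sM (- var i) (?f as)"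
      using slot[of as i] by (simp add: act.sesquilinear_at_def)
  next
    fix as :: "'b list" and \<pi> assume "length as = q \<and> \<pi> permutes {..<q}"
    then show "cochain_at sM ?f (permute_list \<pi> (vars q)) (permute_list \<pi> as)
        = pscale sM (of_int (sign \<pi>)) (?f as)"
      using perm by blast
  qed (simp add: restrict_to_vars_def)
qed

lemma basic_cochainsD:
  assumes "f \<in> basic_cochains sA sM q"
  shows "length as \<noteq> q \<Longrightarrow> f as = 0"
    and "length as = q \<Longrightarrow> \<alpha> \<in> supp (f as) \<Longrightarrow> supp \<alpha> \<subseteq> {..<q}"
    and "length as = q \<Longrightarrow> i < q \<Longrightarrow> f (as[i := x + y]) = f (as[i := x]) + f (as[i := y])"
    and "length as = q \<Longrightarrow> i < q \<Longrightarrow>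
      f (as[i := sA [:c:] (as ! i)]) = pscale sM (const [:c:]) (f as)"
    and "length as = q \<Longrightarrow> i < q \<Longrightarrow>
      f (as[i := sA [:0, 1:] (as ! i)]) = pscale sM (- var i) (f as)"
    and "length as = q \<Longrightarrow> \<pi> permutes {..<q} \<Longrightarrow>
      cochain_at sM f (permute_list \<pi> (vars q)) (permute_list \<pi> as)
        = pscale sM (of_int (sign \<pi>)) (f as)"
  using assms unfolding basic_cochains_def by blast+

lemma restrict_eval:
  assumes "f \<in> basic_cochains sA sM q"
  shows "restrict_to_vars q (eval_cochain f) = f"
proof
  fix as
  show "restrict_to_vars q (eval_cochain f) as = f as"
  proof (cases "length as = q")
    case True
    then have "eval_cochain f (zip (vars q) as) = psubst sM ((!) (vars q)) (f as)"
      by (simp add: eval_cochain_def cochain_at_def)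
    also have "\<dots> = psubst sM var (f as)"
      by (rule act.psubst_cong[OF basic_cochainsD(2)[OF assms True]]) auto
    finally show ?thesis using True by (simp add: restrict_to_vars_def)
  next
    case False
    then show ?thesis using basic_cochainsD(1)[OF assms] by (simp add: restrict_to_vars_def)
  qed
qed

lemma eval_length: "f \<in> basic_cochains sA sM q \<Longrightarrow> length xs \<noteq> q \<Longrightarrow> eval_cochain f xs = 0"
  using basic_cochainsD(1)[of f q "map snd xs"] by (simp add: eval_cochain_def cochain_at_def)

lemma natural_eval:
  assumes "f \<in> basic_cochains sA sM q"
  shows "natural P (eval_cochain f)"
  unfolding natural_def
proof (intro allI impI)
  fix \<tau> :: "nat \<Rightarrow> 'a poly mpol" and xs :: "('a, 'b) arg list"
  show "psubst sM \<tau> (eval_cochain f xs) = eval_cochain f (map (arg_subst \<tau>) xs)"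
  proof (cases "length xs = q")
    case True
    have "psubst sM \<tau> (eval_cochain f xs)
        = psubst sM (\<lambda>i. rsubst \<tau> (map fst xs ! i)) (f (map snd xs))"
      by (simp add: eval_cochain_def cochain_at_def act.psubst_psubst)
    also have "\<dots> = psubst sM ((!) (map fst (map (arg_subst \<tau>) xs))) (f (map snd xs))"
      by (rule act.psubst_cong[OF basic_cochainsD(2)[OF assms]]) (use True in auto)
    finally show ?thesis by (simp add: eval_cochain_def cochain_at_def comp_def)
  next
    case False
    then show ?thesis by (simp add: eval_length[OF assms])
  qed
qed

text \<open>
  The skew-symmetry of a cochain is an identity of polynomials in the formal variables. Substituting
  the first components of \<open>xs\<close> yields the identity for arbitrary arguments.
\<close>

lemma eval_permute:
  assumes "f \<in> basic_cochains sA sM q" "length xs = q" "\<pi> permutes {..<q}"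
  shows "eval_cochain f (permute_list \<pi> xs) = pscale sM (of_int (sign \<pi>)) (eval_cochain f xs)"
proof -
  let ?\<sigma> = "(!) (map fst xs)" and ?as = "map snd xs"
  have \<pi>: "\<pi> permutes {..<length (map fst xs)}" "\<pi> permutes {..<length xs}"
    "\<pi> permutes {..<length (vars q :: 'a poly mpol list)}"
    using assms by simp_all
  have "eval_cochain f (permute_list \<pi> xs)
      = psubst sM ((!) (permute_list \<pi> (map fst xs))) (f (permute_list \<pi> ?as))"
    by (simp add: eval_cochain_def cochain_at_def permute_list_map \<pi>)
  also have "\<dots> = psubst sM (\<lambda>i. rsubst ?\<sigma> (permute_list \<pi> (vars q) ! i)) (f (permute_list \<pi> ?as))"
    by (rule act.psubst_cong[OF basic_cochainsD(2)[OF assms(1)]])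
       (use assms permutes_in_image[OF assms(3)] in \<open>auto simp: permute_list_nth[OF \<pi>(1)] permute_list_nth[OF \<pi>(3)]\<close>)
  also have "\<dots> = psubst sM ?\<sigma> (cochain_at sM f (permute_list \<pi> (vars q)) (permute_list \<pi> ?as))"
    by (simp add: cochain_at_def act.psubst_psubst)
  also have "\<dots> = psubst sM ?\<sigma> (pscale sM (of_int (sign \<pi>)) (f ?as))"
    using basic_cochainsD(6)[OF assms(1), of ?as \<pi>] assms by simp
  also have "\<dots> = pscale sM (of_int (sign \<pi>)) (eval_cochain f xs)"
    by (simp add: eval_cochain_def cochain_at_def sign_def act.psubst_minus)
  finally show ?thesis .
qed

lemma sesquilinear_eval:
  assumes "f \<in> basic_cochains sA sM q"
  shows "sesquilinear (eval_cochain f)"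
  unfolding sesquilinear_def
proof (intro conjI allI)
  show "alternating (eval_cochain f)"
  proof (rule alternatingI)
    fix us vs :: "('a, 'b) arg list" and x y
    let ?xs = "us @ y # x # vs"
    let ?\<pi> = "Transposition.transpose (length us) (Suc (length us))"
    show "eval_cochain f (us @ x # y # vs) = - eval_cochain f ?xs"
    proof (cases "length ?xs = q")
      case True
      have perm: "?\<pi> permutes {..<length ?xs}"
        by (intro permutes_swap_id) auto
      have "permute_list ?\<pi> ?xs = us @ x # y # vs"
      proof (rule nth_equalityI)
        fix i assume "i < length (permute_list ?\<pi> ?xs)"
        then have i: "i < length ?xs" by simp
        have "i < length us \<or> i = length us \<or> i = Suc (length us)
            \<or> (\<exists>k. i = Suc (Suc (length us + k)))"
          by presburger
        then show "permute_list ?\<pi> ?xs ! i = (us @ x # y # vs) ! i"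
          unfolding permute_list_nth[OF perm i]
          by (auto simp: Transposition.transpose_def nth_append)
      qed simp
      moreover have "?\<pi> permutes {..<q}" using perm True by simp
      ultimately show ?thesis
        using eval_permute[OF assms True, of ?\<pi>] by (simp add: sign_swap_id)
    next
      case False
      then show ?thesis by (simp add: eval_length[OF assms])
    qed
  qed
next
  fix \<sigma> and xs :: "('a, 'b) arg list"
  show "act.sesquilinear_at sA \<sigma> (\<lambda>a. eval_cochain f ((\<sigma>, a) # xs))"
  proof (cases "Suc (length xs) = q")
    case True
    let ?as = "map snd xs" and ?\<sigma> = "(!) (\<sigma> # map fst xs)"
    have "f (sA [:0, 1:] a # ?as) = pscale sM (- var 0) (f (a # ?as))"
      "f (sA [:c:] a # ?as) = pscale sM (const [:c:]) (f (a # ?as))"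
      "f ((a + b) # ?as) = f (a # ?as) + f (b # ?as)" for a b c
      using basic_cochainsD(5)[OF assms, of "a # ?as" 0] basic_cochainsD(4)[OF assms, of "a # ?as" 0]
        basic_cochainsD(3)[OF assms, of "a # ?as" 0 a b] True by simp_all
    then show ?thesis
      by (simp add: act.sesquilinear_at_def additive_def eval_cochain_def cochain_at_def
          act.psubst_add act.psubst_pscale act.psubst_minus)
  next
    case False
    then show ?thesis
      using eval_length[OF assms] by (simp add: act.sesquilinear_at_0)
  qed
qed

end

section \<open>The complex\<close>

lemma nths_omit:
  "nths (x # xs) (- {0}) = xs"
  "nths (x # xs) (- {Suc k}) = x # nths xs (- {k})"
  "nths (x # xs) (- {0, Suc l}) = nths xs (- {l})"
  "nths (x # xs) (- {Suc k, Suc l}) = x # nths xs (- {k, l})"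
proof -
  have "{j. Suc j \<in> - {0}} = UNIV" "{j. Suc j \<in> - {Suc k}} = - {k}"
    "{j. Suc j \<in> - {0, Suc l}} = - {l}" "{j. Suc j \<in> - {Suc k, Suc l}} = - {k, l}"
    by auto
  then show "nths (x # xs) (- {0}) = xs"
    "nths (x # xs) (- {Suc k}) = x # nths xs (- {k})"
    "nths (x # xs) (- {0, Suc l}) = nths xs (- {l})"
    "nths (x # xs) (- {Suc k, Suc l}) = x # nths xs (- {k, l})"
    by (simp_all only: nths_Cons) (simp_all add: nths_all)
qed

context lca_module
begin

text \<open>
  Skew-symmetry moves the bracket from position \<open>l\<close> to the front at the cost of the sign \<open>(-1)\<^sup>l\<close>.
\<close>

lemma bracket_args_eq_sum:
  assumes "alternating \<Phi>"
  shows "bracket_args x \<Phi> ys = (\<Sum>l<length ys. pscale sM ((- 1) ^ l)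
    (at_bracket (\<lambda>z. \<Phi> (z # nths ys (- {l}))) x (ys ! l)))"
  using assms
proof (induction ys arbitrary: \<Phi>)
  case (Cons y ys)
  have "(\<lambda>z. \<Phi> (y # z # zs)) = (\<lambda>z. - \<Phi> (z # y # zs))" for zs
    by (rule ext) (rule alternating_swap[OF Cons.prems])
  then show ?case
    by (simp add: Cons.IH[OF alternating_Cons[OF Cons.prems]] sum.lessThan_Suc_shift nths_omit
        at_bracket_minus del: sum.lessThan_Suc)
qed simp

text \<open>
  In the recursion, \<open>\<theta>\<^sub>x \<Phi>\<close> provides the terms in which the first entry acts or is bracketed. In the others
  it stays an argument of \<open>\<Phi>\<close>, every index is shifted by one, and the two arguments in front are
  exchanged in the terms with a bracket.
\<close>

lemma cartan_d_eq_sum: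
  assumes "alternating \<Phi>"
  shows "cartan_d \<Phi> xs =
    (\<Sum>k<length xs. pscale sM ((- 1) ^ k) (act_at (xs ! k) (\<Phi> (nths xs (- {k})))))
    + (\<Sum>l<length xs. \<Sum>k<l. pscale sM ((- 1) ^ (k + l))
        (at_bracket (\<lambda>z. \<Phi> (z # nths xs (- {k, l}))) (xs ! k) (xs ! l)))"
  using assms
proof (induction xs arbitrary: \<Phi>)
  case (Cons x xs)
  have "(\<lambda>z. \<Phi> (x # z # zs)) = (\<lambda>z. - \<Phi> (z # x # zs))" for zs
    by (rule ext) (rule alternating_swap[OF Cons.prems])
  then show ?case
    by (simp add: Cons.IH[OF alternating_Cons[OF Cons.prems]] sum.lessThan_Suc_shift nths_omit
        at_bracket_minus lie_derivative_def bracket_args_eq_sum[OF Cons.prems] sum.distrib sum_subtractf sum_negf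
        del: sum.lessThan_Suc)
qed simp

lemma basic_d_eq:
  assumes "f \<in> basic_cochains sA sM q"
  shows "basic_d sA br sM act q f = restrict_to_vars (Suc q) (cartan_d (eval_cochain f))"
proof
  fix as
  note sesq = sesquilinear_eval[OF assms]
  show "basic_d sA br sM act q f as = restrict_to_vars (Suc q) (cartan_d (eval_cochain f)) as"
  proof (cases "length as = Suc q")
    case True
    let ?xs = "zip (vars (Suc q)) as"
    have nths: "map fst (nths ?xs I) = nths (vars (Suc q)) I" "map snd (nths ?xs I) = nths as I" for I
      using True by (simp_all flip: nths_map)
    have eval_nths: "eval_cochain f (nths ?xs I) = cochain_at sM f (nths (vars (Suc q)) I) (nths as I)"
      for I
      by (simp add: eval_cochain_def nths)
    have bracket: "at_bracket (\<lambda>z. eval_cochain f (z # zs)) (var k, a) (var l, b)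
        = cochain_ext sM f ((var k + var l) # map fst zs)
            (lam_at sA br (var k) (const a) (const b)) (map snd zs)" for zs k l a b
    proof -
      let ?\<psi> = "\<lambda>c. eval_cochain f ((var k + var l, c) # zs)"
      have \<psi>: "additive ?\<psi>"
        using sesq by (simp add: sesquilinear_def act.sesquilinear_at_def)
      have "at_bracket (\<lambda>z. eval_cochain f (z # zs)) (var k, a) (var l, b)
          = lin_ext var ?\<psi> (lam_at sA br (var k) (const a) (const b))"
        using \<psi> by (simp add: at_bracket_eq br.lam_at_const lin_ext_peval[OF \<psi> lin_ext_var[OF \<psi>]])
      then show ?thesis
        by (simp add: lin_ext_def lsum_def cochain_ext_def eval_cochain_def)
    qed
    have "cartan_d (eval_cochain f) ?xs = basic_d sA br sM act q f as"
      unfolding cartan_d_eq_sum[OF conjunct1[OF sesq[unfolded sesquilinear_def]]] basic_d_def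
      using True by (simp add: bracket nths eval_nths del: sum.lessThan_Suc)
    then show ?thesis using True by (simp add: restrict_to_vars_def)
  next
    case False
    then show ?thesis by (simp add: restrict_to_vars_def basic_d_def)
  qed
qed

lemma natural_cartan_d:
  "natural P \<Phi> \<Longrightarrow> (\<And>r. del_free r \<Longrightarrow> P r) \<Longrightarrow> natural del_free (cartan_d \<Phi>)"
  unfolding natural_def by (intro allI impI psubst_cartan_d) auto

lemma basic_d_closed:
  assumes "f \<in> basic_cochains sA sM q"
  shows "basic_d sA br sM act q f \<in> basic_cochains sA sM (Suc q)"
  unfolding basic_d_eq[OF assms]
  by (intro restrict_cochain natural_cartan_d[OF natural_eval[OF assms]] alternating_cartan_d
      sesquilinear_at_cartan_d sesquilinear_eval[OF assms])

lemma eval_basic_d: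
  assumes "f \<in> basic_cochains sA sM q" "length xs = Suc q" "\<And>x. x \<in> set xs \<Longrightarrow> del_free (fst x)"
  shows "eval_cochain (basic_d sA br sM act q f) xs = cartan_d (eval_cochain f) xs"
  unfolding basic_d_eq[OF assms(1)]
  by (intro eval_restrict[where P = del_free] natural_cartan_d[OF natural_eval[OF assms(1)]])
     (simp_all add: del_free.var assms)

text \<open>
  The form used for operations on cochains other than \<open>d\<close>: the result is again natural for all
  substitutions, also for those involving \<open>\<partial>\<close>.
\<close>

lemma restrict_sesquilinear_cochain:
  "natural (\<lambda>_. True) \<Phi> \<Longrightarrow> sesquilinear \<Phi> \<Longrightarrow> restrict_to_vars q \<Phi> \<in> basic_cochains sA sM q"
  by (intro restrict_cochain) (auto simp: natural_def sesquilinear_def)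

lemma eval_restrict_sesquilinear:
  assumes "natural (\<lambda>_. True) \<Phi>" "\<And>xs. length xs \<noteq> q \<Longrightarrow> \<Phi> xs = 0"
  shows "eval_cochain (restrict_to_vars q \<Phi>) = \<Phi>"
proof
  fix xs
  show "eval_cochain (restrict_to_vars q \<Phi>) xs = \<Phi> xs"
  proof (cases "length xs = q")
    case True
    then show ?thesis by (intro eval_restrict[OF assms(1)]) simp_all
  next
    case False
    then show ?thesis
      using assms(2) by (simp add: eval_cochain_def cochain_at_def restrict_to_vars_def)
  qed
qed

lemma sesquilinear_add:
  assumes "sesquilinear \<Phi>" "sesquilinear \<Phi>'"
  shows "sesquilinear (\<lambda>xs. \<Phi> xs + \<Phi>' xs)"
proof -
  have "alternating (\<lambda>xs. \<Phi> xs + \<Phi>' xs)"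
  proof (rule alternatingI)
    fix us x y vs
    show "\<Phi> (us @ x # y # vs) + \<Phi>' (us @ x # y # vs)
      = - (\<Phi> (us @ y # x # vs) + \<Phi>' (us @ y # x # vs))"
      using assms alternatingD[of \<Phi> us x y vs] alternatingD[of \<Phi>' us x y vs]
      by (simp add: sesquilinear_def)
  qed
  then show ?thesis
    using assms by (simp add: sesquilinear_def act.sesquilinear_at_add)
qed

lemma sesquilinear_pscale:
  assumes "sesquilinear \<Phi>"
    and "\<And>us x y vs. g (us @ x # y # vs) = g (us @ y # x # vs)"
  shows "sesquilinear (\<lambda>xs. pscale sM (g (map fst xs)) (\<Phi> xs))"
proof -
  have alt: "alternating \<Phi>" using assms(1) by (simp add: sesquilinear_def)
  have "alternating (\<lambda>xs. pscale sM (g (map fst xs)) (\<Phi> xs))"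
  proof (rule alternatingI)
    fix us x y vs
    show "pscale sM (g (map fst (us @ x # y # vs))) (\<Phi> (us @ x # y # vs))
        = - pscale sM (g (map fst (us @ y # x # vs))) (\<Phi> (us @ y # x # vs))"
      using assms(2)[of "map fst us" "fst x" "fst y" "map fst vs"]
        alternatingD[OF alt, of us x y vs] by simp
  qed
  moreover have "act.sesquilinear_at sA \<sigma> (\<lambda>a. pscale sM (g (map fst ((\<sigma>, a) # xs))) (\<Phi> ((\<sigma>, a) # xs)))"
    for \<sigma> xs
    unfolding list.map fst_conv
    using assms(1) by (intro act.sesquilinear_at_pscale) (simp add: sesquilinear_def)
  ultimately show ?thesis by (simp add: sesquilinear_def)
qed

lemma eval_cochain_add: "eval_cochain (f + g) = (\<lambda>xs. eval_cochain f xs + eval_cochain g xs)"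
  by (rule ext) (simp add: eval_cochain_def cochain_at_def act.psubst_add)

lemma cochains_add:
  assumes "f \<in> basic_cochains sA sM q" "g \<in> basic_cochains sA sM q"
  shows "f + g \<in> basic_cochains sA sM q"
proof -
  have "restrict_to_vars q (\<lambda>xs. eval_cochain f xs + eval_cochain g xs) \<in> basic_cochains sA sM q"
    using natural_eval[OF assms(1), of "\<lambda>_. True"] natural_eval[OF assms(2), of "\<lambda>_. True"]
    by (intro restrict_sesquilinear_cochain sesquilinear_add sesquilinear_eval[OF assms(1)]
        sesquilinear_eval[OF assms(2)]) (simp add: natural_def act.psubst_add)
  also have "restrict_to_vars q (\<lambda>xs. eval_cochain f xs + eval_cochain g xs)
      = restrict_to_vars q (eval_cochain f) + restrict_to_vars q (eval_cochain g)"
    by (auto simp: restrict_to_vars_def)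
  finally show "f + g \<in> basic_cochains sA sM q"
    by (simp only: restrict_eval[OF assms(1)] restrict_eval[OF assms(2)])
qed

lemma cochains_scalar:
  assumes "f \<in> basic_cochains sA sM q"
  shows "(\<lambda>as. pscale sM (const [:c:]) (f as)) \<in> basic_cochains sA sM q"
proof -
  have "natural (\<lambda>_. True) (\<lambda>xs. pscale sM (const [:c:]) (eval_cochain f xs))"
    using natural_eval[OF assms, of "\<lambda>_. True"] by (simp add: natural_def act.psubst_pscale)
  then have "restrict_to_vars q (\<lambda>xs. pscale sM (const [:c:]) (eval_cochain f xs))
      \<in> basic_cochains sA sM q"
    using sesquilinear_pscale[OF sesquilinear_eval[OF assms], of "\<lambda>_. const [:c:]"]
    by (intro restrict_sesquilinear_cochain) simp_all
  also have "restrict_to_vars q (\<lambda>xs. pscale sM (const [:c:]) (eval_cochain f xs))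
      = (\<lambda>as. pscale sM (const [:c:]) (restrict_to_vars q (eval_cochain f) as))"
    by (auto simp: restrict_to_vars_def)
  finally show ?thesis by (simp only: restrict_eval[OF assms])
qed

lemma cochains_minus:
  assumes "f \<in> basic_cochains sA sM q"
  shows "- f \<in> basic_cochains sA sM q"
  using cochains_scalar[OF assms, of "- 1"] by (simp add: const_minus_1 fun_Compl_def)

lemma cochains_0: "0 \<in> basic_cochains sA sM q"
proof -
  have "restrict_to_vars q (\<lambda>_. 0) \<in> basic_cochains sA sM q"
    by (intro restrict_sesquilinear_cochain)
       (simp_all add: natural_def sesquilinear_def alternating_def act.sesquilinear_at_0)
  also have "restrict_to_vars q (\<lambda>_. 0) = 0" by (auto simp: restrict_to_vars_def)
  finally show ?thesis .
qed

lemma basic_d_add: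
  assumes "f \<in> basic_cochains sA sM q" "g \<in> basic_cochains sA sM q"
  shows "basic_d sA br sM act q (f + g) = basic_d sA br sM act q f + basic_d sA br sM act q g"
  by (rule ext)
     (simp add: basic_d_eq assms cochains_add eval_cochain_add cartan_d_add restrict_to_vars_def)

lemma weight_vars: "length as = q \<Longrightarrow> weight (zip (vars q) as) = (\<Sum>k<q. var k)"
  by (simp add: vars_def interv_sum_list_conv_sum_set_nat lessThan_atLeast0)

lemma cochain_del_eq:
  assumes "f \<in> basic_cochains sA sM q"
  shows "cochain_del sM q f
    = restrict_to_vars q (\<lambda>xs. pscale sM (del + weight xs) (eval_cochain f xs))"
proof
  fix as
  show "cochain_del sM q f as
    = restrict_to_vars q (\<lambda>xs. pscale sM (del + weight xs) (eval_cochain f xs)) as"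
  proof (cases "length as = q")
    case True
    then have "eval_cochain f (zip (vars q) as) = f as"
      using fun_cong[OF restrict_eval[OF assms], of as] by (simp add: restrict_to_vars_def)
    then show ?thesis
      using True weight_vars[OF True] by (simp add: cochain_del_def restrict_to_vars_def)
  next
    case False
    then show ?thesis
      using basic_cochainsD(1)[OF assms] by (simp add: cochain_del_def restrict_to_vars_def)
  qed
qed

lemma
  assumes "f \<in> basic_cochains sA sM q"
  shows cochain_del_closed: "cochain_del sM q f \<in> basic_cochains sA sM q"
    and eval_cochain_del:
      "eval_cochain (cochain_del sM q f) = (\<lambda>xs. pscale sM (del + weight xs) (eval_cochain f xs))"
proof -
  have "rsubst \<tau> (weight xs) = weight (map (arg_subst \<tau>) xs)" for \<tau> and xs :: "('a, 'b) arg list"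
    by (induction xs) (simp_all add: R.psubst_add)
  then have nat: "natural (\<lambda>_. True) (\<lambda>xs. pscale sM (del + weight xs) (eval_cochain f xs))"
    using natural_eval[OF assms, of "\<lambda>_. True"]
    by (simp add: natural_def act.psubst_pscale R.psubst_add)
  show "cochain_del sM q f \<in> basic_cochains sA sM q"
    unfolding cochain_del_eq[OF assms]
    by (intro restrict_sesquilinear_cochain nat
        sesquilinear_pscale[OF sesquilinear_eval[OF assms], of "\<lambda>\<sigma>s. del + sum_list \<sigma>s"])
       (simp add: add_ac)
  show "eval_cochain (cochain_del sM q f) = (\<lambda>xs. pscale sM (del + weight xs) (eval_cochain f xs))"
    unfolding cochain_del_eq[OF assms]
    by (rule eval_restrict_sesquilinear[OF nat]) (simp add: eval_length[OF assms])
qed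

lemma basic_d_cochain_del:
  assumes "f \<in> basic_cochains sA sM q"
  shows "basic_d sA br sM act q (cochain_del sM q f)
    = cochain_del sM (Suc q) (basic_d sA br sM act q f)"
proof
  fix as
  show "basic_d sA br sM act q (cochain_del sM q f) as
    = cochain_del sM (Suc q) (basic_d sA br sM act q f) as"
  proof (cases "length as = Suc q")
    case True
    let ?xs = "zip (vars (Suc q)) as"
    have "\<forall>x\<in>set ?xs. del_free (fst x)"
      by (auto simp: vars_def del_free.var dest!: set_zip_leftD)
    then have "cartan_d (\<lambda>ys. pscale sM (del + 0 + weight ys) (eval_cochain f ys)) ?xs
        = pscale sM (del + 0 + weight ?xs) (cartan_d (eval_cochain f) ?xs)"
      by (intro cartan_d_del) simp_all
    moreover have "basic_d sA br sM act q (cochain_del sM q f) as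
        = cartan_d (\<lambda>ys. pscale sM (del + weight ys) (eval_cochain f ys)) ?xs"
      using True
      by (simp add: basic_d_eq[OF cochain_del_closed[OF assms]] eval_cochain_del[OF assms]
          restrict_to_vars_def)
    moreover have "cochain_del sM (Suc q) (basic_d sA br sM act q f) as
        = pscale sM (del + weight ?xs) (cartan_d (eval_cochain f) ?xs)"
      using True by (simp only: cochain_del_def basic_d_eq[OF assms] restrict_to_vars_def
          weight_vars[OF True] refl if_True)
    ultimately show ?thesis by simp
  next
    case False
    then show ?thesis by (simp add: basic_d_def cochain_del_def)
  qed
qed

lemma cochain_del_add:
  "cochain_del sM q (f + g) = cochain_del sM q f + cochain_del sM q g"
  by (rule ext) (simp add: cochain_del_def act.P.scale_right_distrib)

end

section \<open>The contracting homotopy\<close>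

text \<open>
  What the argument uses of \<open>W(0)\<close> and of its module: the endomorphism \<open>H\<^sub>0\<close>, the constant coefficient of
  the action of \<open>H\<close>, is a nonzero scalar on the module and vanishes on the algebra.
\<close>

locale invertible_zero_mode = lca_module sA br sM act
  for sA :: "'a::field poly \<Rightarrow> 'b::ab_group_add \<Rightarrow> 'b" and br
    and sM :: "'a poly \<Rightarrow> 'm::ab_group_add \<Rightarrow> 'm" and act +
  fixes H :: 'b and \<beta> :: 'a
  assumes bracket_zero_mode: "coeff (br H b) 0 = 0"
    and act_zero_mode: "coeff (act H v) 0 = sM [:\<beta>:] v"
    and nonzero: "\<beta> \<noteq> 0"
begin

text \<open>
  At \<open>\<sigma> = 0\<close> only the constant coefficients of the action and of the brackets contribute.
\<close>

lemma lie_derivative_zero_mode: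
  assumes "sesquilinear \<Phi>"
  shows "lie_derivative (0, H) \<Phi> xs = pscale sM (const [:\<beta>:]) (\<Phi> xs)"
proof -
  have act_H: "lam_at sM act 0 (const H) v = pscale sM (const [:\<beta>:]) v" for v
  proof (induction v rule: mpol_induct)
    case (single \<gamma> w)
    have "lam_at sM act 0 (const H) (Poly_Mapping.single \<gamma> w)
        = pscale sM (lmonom \<gamma>) (pscale sM (const [:\<beta>:]) (const w))"
      by (simp add: act.lam_at_single act.peval_0 act_zero_mode act.pscale_const
          del: act.P.scale_scale)
    also have "\<dots> = pscale sM (const [:\<beta>:]) (Poly_Mapping.single \<gamma> w)"
      by (simp add: act.single_eq mult.commute)
    finally show ?case .
  qed (simp add: act.lam_at_add act.P.scale_right_distrib)
  have "bracket_args (0, H) \<Phi> xs = 0"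
    using assms
  proof (induction xs arbitrary: \<Phi>)
    case (Cons y ys)
    have \<psi>: "additive (\<lambda>c. \<Phi> ((fst (0, H) + fst y, c) # ys))"
      using Cons.prems by (simp add: sesquilinear_def act.sesquilinear_at_def)
    have "pscale sM (fst (0, H) ^ n) (\<Phi> ((fst (0, H) + fst y, coeff (br H (snd y)) n) # ys)) = 0" for n
      using additive.zero[OF \<psi>] by (cases n) (simp_all add: bracket_zero_mode)
    then have "at_bracket (\<lambda>z. \<Phi> (z # ys)) (0, H) y = 0"
      by (subst at_bracket_eq[OF \<psi>]) simp
    then show ?case using Cons.IH[OF sesquilinear_Cons[OF Cons.prems]] by simp
  qed simp
  then show ?thesis by (simp add: lie_derivative_def act_H)
qed

definition contraction :: "nat \<Rightarrow> ('b list \<Rightarrow> 'm mpol) \<Rightarrow> 'b list \<Rightarrow> 'm mpol"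
  where "contraction q f =
    restrict_to_vars q (\<lambda>xs. pscale sM (const [:inverse \<beta>:]) (eval_cochain f ((0, H) # xs)))"

lemma
  assumes "f \<in> basic_cochains sA sM (Suc q)"
  shows contraction_closed: "contraction q f \<in> basic_cochains sA sM q"
    and eval_contraction: "eval_cochain (contraction q f)
      = (\<lambda>xs. pscale sM (const [:inverse \<beta>:]) (eval_cochain f ((0, H) # xs)))"
proof -
  have nat: "natural (\<lambda>_. True)
      (\<lambda>xs. pscale sM (const [:inverse \<beta>:]) (eval_cochain f ((0, H) # xs)))"
    using natural_eval[OF assms, of "\<lambda>_. True"] by (simp add: natural_def act.psubst_pscale)
  show "contraction q f \<in> basic_cochains sA sM q"
    unfolding contraction_def
    using sesquilinear_pscale[OF sesquilinear_Cons[OF sesquilinear_eval[OF assms]],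
        of "\<lambda>_. const [:inverse \<beta>:]" "(0, H)"]
    by (intro restrict_sesquilinear_cochain nat) simp
  show "eval_cochain (contraction q f)
      = (\<lambda>xs. pscale sM (const [:inverse \<beta>:]) (eval_cochain f ((0, H) # xs)))"
    unfolding contraction_def
    by (rule eval_restrict_sesquilinear[OF nat]) (simp add: eval_length[OF assms])
qed

text \<open>
  The recursion for the differential, evaluated at the first argument \<open>(0, H)\<close>.
\<close>

lemma contraction_d:
  assumes "f \<in> basic_cochains sA sM q" "length as = q"
  shows "contraction q (basic_d sA br sM act q f) as
    = f as - pscale sM (const [:inverse \<beta>:])
        (cartan_d (\<lambda>ys. eval_cochain f ((0, H) # ys)) (zip (vars q) as))"
proof -
  let ?xs = "zip (vars q) as"
  have "eval_cochain (basic_d sA br sM act q f) ((0, H) # ?xs)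
      = cartan_d (eval_cochain f) ((0, H) # ?xs)"
    using assms by (intro eval_basic_d)
      (auto simp: vars_def del_free.var dest!: set_zip_leftD)
  moreover have "eval_cochain f ?xs = f as"
    using fun_cong[OF restrict_eval[OF assms(1)], of as] assms(2)
    by (simp add: restrict_to_vars_def)
  moreover have "const [:inverse \<beta>:] * const [:\<beta>:] = (1 :: 'a poly mpol)"
    using nonzero by (simp add: const_def mult_single flip: one_pCons)
  ultimately show ?thesis
    using assms by (simp add: contraction_def restrict_to_vars_def lie_derivative_zero_mode
        sesquilinear_eval[OF assms(1)] act.P.scale_right_diff_distrib)
qed

lemma homotopy:
  assumes "f \<in> basic_cochains sA sM (Suc q)"
  shows "basic_d sA br sM act q (contraction q f)
    + contraction (Suc q) (basic_d sA br sM act (Suc q) f) = f"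
proof
  fix as
  let ?g = "contraction q f"
  show "(basic_d sA br sM act q ?g
    + contraction (Suc q) (basic_d sA br sM act (Suc q) f)) as = f as"
  proof (cases "length as = Suc q")
    case True
    have "basic_d sA br sM act q ?g as = pscale sM (const [:inverse \<beta>:])
        (cartan_d (\<lambda>ys. eval_cochain f ((0, H) # ys)) (zip (vars (Suc q)) as))"
      using True
      by (simp add: basic_d_eq contraction_closed assms restrict_to_vars_def eval_contraction
          cartan_d_pscale del_free.const)
    then show ?thesis using contraction_d[OF assms True] by simp
  next
    case False
    then show ?thesis
      using basic_cochainsD(1)[OF assms]
      by (simp add: basic_d_def contraction_def restrict_to_vars_def)
  qed
qed

lemma homotopy_0:
  assumes "f \<in> basic_cochains sA sM 0"
  shows "contraction 0 (basic_d sA br sM act 0 f) = f"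
proof
  fix as
  show "contraction 0 (basic_d sA br sM act 0 f) as = f as"
    using contraction_d[OF assms, of as] basic_cochainsD(1)[OF assms, of as]
    by (cases "as = []") (simp_all add: contraction_def restrict_to_vars_def)
qed

lemma contraction_0: "contraction q 0 = 0"
  by (rule ext)
     (simp add: contraction_def restrict_to_vars_def eval_cochain_def cochain_at_def)

text \<open>
  The argument \<open>(0, H)\<close> has weight 0.
\<close>

lemma contraction_del:
  assumes "f \<in> basic_cochains sA sM (Suc q)"
  shows "contraction q (cochain_del sM (Suc q) f) = cochain_del sM q (contraction q f)"
proof -
  have "contraction q (cochain_del sM (Suc q) f)
      = restrict_to_vars q (\<lambda>xs. pscale sM (del + weight xs) (eval_cochain (contraction q f) xs))"
    unfolding contraction_def[of q "cochain_del sM (Suc q) f"] eval_cochain_del[OF assms]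
      eval_contraction[OF assms]
    by (simp add: mult.commute)
  then show ?thesis unfolding cochain_del_eq[OF contraction_closed[OF assms]] .
qed

end

section \<open>Quotients and cohomology groups\<close>

text \<open>
  A coset of the group \<open>I\<close> with a representative in \<open>K \<subseteq> I\<close> is \<open>I\<close> itself, so the quotient has a single
  element.
\<close>

lemma trivial_Mod:
  fixes A :: "'c monoid"
  assumes "group (A\<lparr>carrier := I\<rparr>)" "K \<subseteq> I" "K \<noteq> {}"
  shows "trivial_group (A\<lparr>carrier := K\<rparr> Mod I)"
proof -
  interpret I: group "A\<lparr>carrier := I\<rparr>" by fact
  have "I #>\<^bsub>A\<lparr>carrier := K\<rparr>\<^esub> a = I" if "a \<in> K" for a
    using I.coset_join2[OF _ I.subgroup_self, of a] that assms(2) by (auto simp: r_coset_def)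
  then have carrier: "carrier (A\<lparr>carrier := K\<rparr> Mod I) = {I}"
    using assms(3) by (auto simp: FactGroup_def RCOSETS_def)
  have mult: "I \<otimes>\<^bsub>A\<lparr>carrier := K\<rparr> Mod I\<^esub> I = I"
    using I.subgroup_mult_id[OF I.subgroup_self] by (simp add: FactGroup_def set_mult_def)
  have one: "\<one>\<^bsub>A\<lparr>carrier := K\<rparr> Mod I\<^esub> = I"
    by (simp add: FactGroup_def)
  have "group (A\<lparr>carrier := K\<rparr> Mod I)"
    by (rule groupI) (simp_all only: carrier one singleton_iff mult bex_simps simp_thms)
  then show ?thesis by (simp only: trivial_group_def carrier one)
qed

lemma trivial_cohomology_if_exact:
  fixes G :: "nat \<Rightarrow> 'c monoid"
  assumes grp: "\<And>q. group (G q)"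
    and hom: "\<And>q. d q \<in> hom (G q) (G (Suc q))"
    and exact_0: "kernel (G 0) (G 1) (d 0) \<subseteq> {\<one>\<^bsub>G 0\<^esub>}"
    and exact_Suc: "\<And>q. kernel (G (Suc q)) (G (Suc (Suc q))) (d (Suc q)) \<subseteq> d q ` carrier (G q)"
  shows "trivial_group (cohomology G d q)"
proof -
  define I where "I = (case q of 0 \<Rightarrow> {\<one>\<^bsub>G 0\<^esub>} | Suc p \<Rightarrow> d p ` carrier (G p))"
  have "subgroup I (G q)"
  proof (cases q)
    case 0
    then show ?thesis by (simp add: I_def group.triv_subgroup[OF grp])
  next
    case (Suc p)
    have "group_hom (G p) (G (Suc p)) (d p)"
      by (intro group_hom.intro group_hom_axioms.intro grp hom)
    then show ?thesis using Suc by (simp add: I_def group_hom.img_is_subgroup)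
  qed
  then have "group ((G q)\<lparr>carrier := I\<rparr>)" by (rule subgroup.subgroup_is_group) (rule grp)
  moreover have "kernel (G q) (G (Suc q)) (d q) \<subseteq> I"
    using exact_0 exact_Suc by (cases q) (simp_all add: I_def)
  moreover have "\<one>\<^bsub>G q\<^esub> \<in> kernel (G q) (G (Suc q)) (d q)"
    using hom_one[OF hom grp grp] group.is_monoid[OF grp] by (simp add: kernel_def monoid.one_closed)
  ultimately show ?thesis
    unfolding cohomology_def I_def[symmetric] by (intro trivial_Mod) auto
qed

text \<open>
  Subgroups \<open>D q\<close> that are stable under the differentials, so that these induce maps between the quotients.
\<close>

locale group_subcomplex =
  fixes A :: "nat \<Rightarrow> 'c monoid" and D :: "nat \<Rightarrow> 'c set" and d :: "nat \<Rightarrow> 'c \<Rightarrow> 'c"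
  assumes comm: "comm_group (A q)"
    and sub: "subgroup (D q) (A q)"
    and hom: "d q \<in> hom (A q) (A (Suc q))"
    and stable: "f \<in> D q \<Longrightarrow> d q f \<in> D (Suc q)"
begin

definition quotient_d :: "nat \<Rightarrow> 'c set \<Rightarrow> 'c set"
  where "quotient_d q X = (\<Union>f\<in>X. D (Suc q) #>\<^bsub>A (Suc q)\<^esub> d q f)"

lemma grp: "group (A q)"
  using comm by (simp add: comm_group_def)

lemma normal: "D q \<lhd> A q"
  by (rule comm_group.subgroup_imp_normal[OF comm sub])

lemma quotient_d_coset:
  assumes f: "f \<in> carrier (A q)"
  shows "quotient_d q (D q #>\<^bsub>A q\<^esub> f) = D (Suc q) #>\<^bsub>A (Suc q)\<^esub> d q f"
proof -
  have df: "d q f \<in> carrier (A (Suc q))" using hom_in_carrier[OF hom f] .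
  have "D (Suc q) #>\<^bsub>A (Suc q)\<^esub> d q f' = D (Suc q) #>\<^bsub>A (Suc q)\<^esub> d q f"
    if "f' \<in> D q #>\<^bsub>A q\<^esub> f" for f'
  proof -
    obtain g where g: "g \<in> D q" "f' = g \<otimes>\<^bsub>A q\<^esub> f" using \<open>f' \<in> _\<close> by (auto simp: r_coset_def)
    then have "g \<in> carrier (A q)" using subgroup.mem_carrier[OF sub] by blast
    then have "d q f' = d q g \<otimes>\<^bsub>A (Suc q)\<^esub> d q f" using g f by (simp add: hom_mult[OF hom])
    then have "d q f' \<in> D (Suc q) #>\<^bsub>A (Suc q)\<^esub> d q f"
      using stable[OF g(1)] by (auto simp: r_coset_def)
    then show ?thesis using group.repr_independence[OF grp _ df sub] by simp
  qed
  moreover have "f \<in> D q #>\<^bsub>A q\<^esub> f" by (rule group.rcos_self[OF grp f sub])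
  ultimately show ?thesis unfolding quotient_d_def by blast
qed

lemma carrier_quotientE:
  assumes "X \<in> carrier (A q Mod D q)"
  obtains f where "f \<in> carrier (A q)" "X = D q #>\<^bsub>A q\<^esub> f"
  using assms by (auto simp: FactGroup_def RCOSETS_def)

lemma carrier_quotientI: "f \<in> carrier (A q) \<Longrightarrow> D q #>\<^bsub>A q\<^esub> f \<in> carrier (A q Mod D q)"
  by (auto simp: FactGroup_def RCOSETS_def)

lemma quotient_d_hom: "quotient_d q \<in> hom (A q Mod D q) (A (Suc q) Mod D (Suc q))"
proof (rule homI)
  fix X assume "X \<in> carrier (A q Mod D q)"
  then obtain f where f: "f \<in> carrier (A q)" "X = D q #>\<^bsub>A q\<^esub> f" by (rule carrier_quotientE)
  then show "quotient_d q X \<in> carrier (A (Suc q) Mod D (Suc q))"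
    using carrier_quotientI[OF hom_in_carrier[OF hom f(1)]] by (simp add: quotient_d_coset)
  fix Y assume "Y \<in> carrier (A q Mod D q)"
  then obtain g where g: "g \<in> carrier (A q)" "Y = D q #>\<^bsub>A q\<^esub> g" by (rule carrier_quotientE)
  have "f \<otimes>\<^bsub>A q\<^esub> g \<in> carrier (A q)"
    using f g by (simp add: group.is_monoid[OF grp] monoid.m_closed)
  then show "quotient_d q (X \<otimes>\<^bsub>A q Mod D q\<^esub> Y)
      = quotient_d q X \<otimes>\<^bsub>A (Suc q) Mod D (Suc q)\<^esub> quotient_d q Y"
    using f g hom_in_carrier[OF hom]
    by (simp add: FactGroup_def normal.rcos_sum[OF normal] quotient_d_coset hom_mult[OF hom])
qed

lemma group_quotient: "group (A q Mod D q)"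
  by (rule normal.factorgroup_is_group[OF normal])

lemma quotient_kernelE:
  assumes "X \<in> kernel (A q Mod D q) (A (Suc q) Mod D (Suc q)) (quotient_d q)"
  obtains f where "f \<in> carrier (A q)" "X = D q #>\<^bsub>A q\<^esub> f" "d q f \<in> D (Suc q)"
proof -
  have X: "X \<in> carrier (A q Mod D q)" "quotient_d q X = D (Suc q)"
    using assms by (simp_all add: kernel_def FactGroup_def)
  obtain f where f: "f \<in> carrier (A q)" "X = D q #>\<^bsub>A q\<^esub> f"
    using X(1) by (rule carrier_quotientE)
  moreover have "d q f \<in> D (Suc q)"
    using X(2) group.coset_join1[OF grp _ hom_in_carrier[OF hom f(1)] sub]
    by (simp add: f quotient_d_coset)
  ultimately show ?thesis by (rule that)
qed

end

context lca_module
begin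

lemma comm_group_basic: "comm_group (basic_complex sA sM q)"
proof (rule comm_groupI)
  fix f assume "f \<in> carrier (basic_complex sA sM q)"
  then show "\<exists>g\<in>carrier (basic_complex sA sM q).
      g \<otimes>\<^bsub>basic_complex sA sM q\<^esub> f = \<one>\<^bsub>basic_complex sA sM q\<^esub>"
    by (intro bexI[of _ "- f"]) (simp_all add: basic_complex_def cochains_minus)
qed (simp_all add: basic_complex_def cochains_add cochains_0 add_ac)

lemma subcomplex:
  "group_subcomplex (basic_complex sA sM) (del_cochains sA sM) (basic_d sA br sM act)"
proof (rule group_subcomplex.intro)
  fix q
  show "comm_group (basic_complex sA sM q)" by (rule comm_group_basic)
  then have grp: "group (basic_complex sA sM q)" by (simp add: comm_group_def)
  have "cochain_del sM q \<in> hom (basic_complex sA sM q) (basic_complex sA sM q)"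
    by (intro homI) (simp_all add: basic_complex_def cochain_del_closed cochain_del_add)
  then have "group_hom (basic_complex sA sM q) (basic_complex sA sM q) (cochain_del sM q)"
    by (intro group_hom.intro group_hom_axioms.intro grp)
  from group_hom.img_is_subgroup[OF this]
  show "subgroup (del_cochains sA sM q) (basic_complex sA sM q)"
    by (simp add: del_cochains_def basic_complex_def)
  show "basic_d sA br sM act q \<in> hom (basic_complex sA sM q) (basic_complex sA sM (Suc q))"
    by (intro homI) (simp_all add: basic_complex_def basic_d_closed basic_d_add)
  show "basic_d sA br sM act q f \<in> del_cochains sA sM (Suc q)" if "f \<in> del_cochains sA sM q" for f
    using that by (auto simp: del_cochains_def basic_d_cochain_del basic_d_closed)
qed

end

context invertible_zero_mode
begin

interpretation C: group_subcomplex
  "basic_complex sA sM" "del_cochains sA sM" "basic_d sA br sM act"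
  by (rule subcomplex)

theorem trivial_basic_cohomology: "trivial_group (basic_cohomology sA br sM act q)"
  unfolding basic_cohomology_def
proof (rule trivial_cohomology_if_exact)
  show "kernel (basic_complex sA sM 0) (basic_complex sA sM 1) (basic_d sA br sM act 0)
      \<subseteq> {\<one>\<^bsub>basic_complex sA sM 0\<^esub>}"
  proof
    fix f assume "f \<in> kernel (basic_complex sA sM 0) (basic_complex sA sM 1) (basic_d sA br sM act 0)"
    then have "f \<in> basic_cochains sA sM 0" "basic_d sA br sM act 0 f = 0"
      by (simp_all add: kernel_def basic_complex_def)
    then have "f = 0" using homotopy_0[of f] by (simp add: contraction_0)
    then show "f \<in> {\<one>\<^bsub>basic_complex sA sM 0\<^esub>}" by (simp add: basic_complex_def)
  qed
  fix q
  show "kernel (basic_complex sA sM (Suc q)) (basic_complex sA sM (Suc (Suc q)))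
      (basic_d sA br sM act (Suc q)) \<subseteq> basic_d sA br sM act q ` carrier (basic_complex sA sM q)"
  proof
    fix f assume "f \<in> kernel (basic_complex sA sM (Suc q)) (basic_complex sA sM (Suc (Suc q)))
      (basic_d sA br sM act (Suc q))"
    then have f: "f \<in> basic_cochains sA sM (Suc q)" "basic_d sA br sM act (Suc q) f = 0"
      by (simp_all add: kernel_def basic_complex_def)
    then have "f = basic_d sA br sM act q (contraction q f)"
      using homotopy[OF f(1)] by (simp add: contraction_0)
    then show "f \<in> basic_d sA br sM act q ` carrier (basic_complex sA sM q)"
      using contraction_closed[OF f(1)] by (auto simp: basic_complex_def)
  qed
qed (rule C.grp C.hom)+

text \<open>
  If \<open>d f = \<partial> g\<close>, then \<open>f = d (h f) + h (\<partial> g) = d (h f) + \<partial> (h g)\<close> for the homotopy \<open>h\<close>, so the class of \<open>f\<close> in the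
  reduced complex is the differential of the class of \<open>h f\<close>. In degree 0 there is no term \<open>h f\<close>, and the
  class of \<open>f\<close> is 0.
\<close>

theorem trivial_reduced_cohomology: "trivial_group (reduced_cohomology sA br sM act q)"
proof -
  have d: "reduced_d sA br sM act = C.quotient_d"
    by (intro ext) (simp add: reduced_d_def C.quotient_d_def)
  show ?thesis
    unfolding reduced_cohomology_def reduced_complex_def d
  proof (rule trivial_cohomology_if_exact)
    show "kernel (basic_complex sA sM 0 Mod del_cochains sA sM 0)
        (basic_complex sA sM 1 Mod del_cochains sA sM 1) (C.quotient_d 0)
        \<subseteq> {\<one>\<^bsub>basic_complex sA sM 0 Mod del_cochains sA sM 0\<^esub>}"
    proof
      fix X assume "X \<in> kernel (basic_complex sA sM 0 Mod del_cochains sA sM 0)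
        (basic_complex sA sM 1 Mod del_cochains sA sM 1) (C.quotient_d 0)"
      then obtain f where f: "f \<in> carrier (basic_complex sA sM 0)"
          "X = del_cochains sA sM 0 #>\<^bsub>basic_complex sA sM 0\<^esub> f"
          "basic_d sA br sM act 0 f \<in> del_cochains sA sM 1"
        using C.quotient_kernelE[of X 0] by auto
      from f(3) obtain g where g: "g \<in> basic_cochains sA sM 1"
          "basic_d sA br sM act 0 f = cochain_del sM 1 g"
        by (auto simp: del_cochains_def)
      have "f = cochain_del sM 0 (contraction 0 g)"
        using homotopy_0[of f] contraction_del[of g 0] f(1) g by (simp add: basic_complex_def)
      then have "f \<in> del_cochains sA sM 0"
        using contraction_closed[of g 0] g by (auto simp: del_cochains_def)
      then have "X = del_cochains sA sM 0"
        using group.coset_join2[OF C.grp f(1) C.sub] f(2) by simp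
      then show "X \<in> {\<one>\<^bsub>basic_complex sA sM 0 Mod del_cochains sA sM 0\<^esub>}"
        by (simp add: FactGroup_def)
    qed
    fix q
    let ?Q = "\<lambda>q. basic_complex sA sM q Mod del_cochains sA sM q"
    show "kernel (?Q (Suc q)) (?Q (Suc (Suc q))) (C.quotient_d (Suc q))
        \<subseteq> C.quotient_d q ` carrier (?Q q)"
    proof
      fix X assume "X \<in> kernel (?Q (Suc q)) (?Q (Suc (Suc q))) (C.quotient_d (Suc q))"
      then obtain f where f: "f \<in> carrier (basic_complex sA sM (Suc q))"
          "X = del_cochains sA sM (Suc q) #>\<^bsub>basic_complex sA sM (Suc q)\<^esub> f"
          "basic_d sA br sM act (Suc q) f \<in> del_cochains sA sM (Suc (Suc q))"
        by (rule C.quotient_kernelE)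
      from f(3) obtain g where g: "g \<in> basic_cochains sA sM (Suc (Suc q))"
          "basic_d sA br sM act (Suc q) f = cochain_del sM (Suc (Suc q)) g"
        by (auto simp: del_cochains_def)
      let ?h = "contraction q f"
      have h: "?h \<in> carrier (basic_complex sA sM q)"
        using f(1) by (simp add: basic_complex_def contraction_closed)
      have "f = cochain_del sM (Suc q) (contraction (Suc q) g) + basic_d sA br sM act q ?h"
        using homotopy[of f q] contraction_del[OF g(1)] f(1) g(2)
        by (simp add: basic_complex_def add.commute)
      then have "f \<in> del_cochains sA sM (Suc q)
          #>\<^bsub>basic_complex sA sM (Suc q)\<^esub> basic_d sA br sM act q ?h"
        using contraction_closed[OF g(1)]
        by (auto simp: r_coset_def del_cochains_def basic_complex_def)
      then have "X = C.quotient_d q (del_cochains sA sM q #>\<^bsub>basic_complex sA sM q\<^esub> ?h)"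
        using group.repr_independence[OF C.grp _ hom_in_carrier[OF C.hom h] C.sub] f(2)
        by (simp add: C.quotient_d_coset[OF h])
      then show "X \<in> C.quotient_d q ` carrier (?Q q)"
        using C.carrier_quotientI[OF h] by blast
    qed
  qed (rule C.group_quotient C.quotient_d_hom)+
qed

end

section \<open>The algebra \<open>W(0)\<close>\<close>

context conformal_product
begin

text \<open>
  At \<open>\<lambda> = 0\<close> the sesquilinearity in the second argument says that the operator commutes with \<open>\<partial>\<close>. It is
  therefore enough to know it on generators over \<open>F[\<partial>]\<close>.
\<close>

lemma zero_mode_linear: "coeff (op a (s p v)) 0 = s p (coeff (op a v) 0)"
proof (induction p)
  case 0
  show ?case by simp
next
  case (pCons c p)
  have del: "coeff (op a (s [:0, 1:] w)) 0 = s [:0, 1:] (coeff (op a w) 0)" for w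
  proof -
    have "const (coeff (op a (s [:0, 1:] w)) 0) = const (s [:0, 1:] (coeff (op a w) 0))"
      using peval_op_del_right[of 0 a w] by (simp only: peval_0 del_def pscale_const add_0_right)
    then show ?thesis by (simp only: const_def inj_eq[OF inj_single])
  qed
  have "pCons c p = [:c:] + [:0, 1:] * p" by simp
  then have split: "s (pCons c p) w = s [:c:] w + s [:0, 1:] (s p w)" for w
    by (simp only: scale_left_distrib scale_scale)
  show ?case
    by (simp only: split op_add_right coeff_add op_scale_right coeff_map_poly scale_zero_right
        del pCons.IH)
qed

end

theorem theorem4p10:
  fixes sA :: "'a::field_char_0 poly \<Rightarrow> 'b::ab_group_add \<Rightarrow> 'b"
    and br :: "'b \<Rightarrow> 'b \<Rightarrow> 'b poly"
    and L H :: 'b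
    and sM :: "'a poly \<Rightarrow> 'm::ab_group_add \<Rightarrow> 'm"
    and act :: "'b \<Rightarrow> 'm \<Rightarrow> 'm poly"
    and m :: 'm
    and \<Delta> \<beta> :: 'a
  assumes "is_W0 sA br L H"
    and "is_M0 sA br L H sM act m \<Delta> \<beta>"
    and "\<beta> \<noteq> 0"
  shows "\<forall>q. trivial_group (basic_cohomology sA br sM act q)
           \<and> trivial_group (reduced_cohomology sA br sM act q)"
proof -
  interpret lca_module sA br sM act using assms(2) by (simp add: is_M0_def)
  have W0: "span {L, H} = UNIV" "br H L = [:0, H:]" "br H H = 0"
    using assms(1) by (simp_all add: is_W0_def free_on_def)
  have M0: "M.span {m} = UNIV" "act H m = [:sM [:\<beta>:] m:]"
    using assms(2) by (simp_all add: is_M0_def free_on_def)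
  have "invertible_zero_mode sA br sM act H \<beta>"
  proof
    let ?V = "{b. coeff (br H b) 0 = 0}"
    have "subspace ?V"
      by (rule subspaceI) (simp_all add: br.op_add_right br.zero_mode_linear)
    then have "span {L, H} \<subseteq> ?V" by (intro span_minimal) (simp_all add: W0)
    then show "coeff (br H b) 0 = 0" for b using W0(1) by blast
    show "coeff (act H v) 0 = sM [:\<beta>:] v" for v
    proof -
      have "v \<in> range (\<lambda>p. sM p m)" using M0(1) by (simp add: M.span_singleton)
      then obtain p where "v = sM p m" by blast
      then show ?thesis by (simp add: act.zero_mode_linear M0 mult.commute)
    qed
    show "\<beta> \<noteq> 0" by fact
  qed
  then interpret invertible_zero_mode sA br sM act H \<beta> .
  show ?thesis using trivial_basic_cohomology trivial_reduced_cohomology by blast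
qed

end
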